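(* Let $\mathbb{F}_q$ be a finite field with $q$ elements and let $\vec{m}=(m_1,\dots,m_n)$ be an $n$-tuple of positive integers such that the circulant ring $\mathcal{C}_{\vec{m}/\mathbb{F}_q}=\mathbb{F}_q[X_1,\dots,X_n]/(X_1^{m_1}-1,\dots,X_n^{m_n}-1)$ is semisimple. For $\vec{d}=(d_1,\dots,d_n)\in\operatorname{Div}_{\vec{m}}$ define $$\nu(\vec{d})=\operatorname{lcm}_{1\le i\le n}\bigl(\operatorname{ord}_{m_i/d_i}(q)\bigr),\qquad \eta(\vec{d})=\frac{\prod_{i=1}^n\varphi(m_i/d_i)}{\nu(\vec{d})}.$$ Then the Wedderburn decomposition of $\mathcal{C}_{\vec{m}/\mathbb{F}_q}$ into simple components is, up to isomorphism, $$\mathcal{C}_{\vec{m}/\mathbb{F}_q}\cong\bigoplus_{\vec{d}\in\operatorname{Div}_{\vec{m}}}\bigl(\mathbb{F}_{q^{\nu(\vec{d})}}\bigr)^{\eta(\vec{d})}.$$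
   Context: A ring is semisimple if it is isomorphic to a finite direct sum of simple rings (for commutative rings, fields), called its simple components; the direct sum decomposition is the Wedderburn decomposition. $\operatorname{Div}_m$ is the set of positive divisors of $m$ (including $1$ and $m$) and $\operatorname{Div}_{\vec{m}}=\operatorname{Div}_{m_1}\times\dots\times\operatorname{Div}_{m_n}$. $\operatorname{ord}_m(a)$ is the multiplicative order of $a$ in $(\mathbb{Z}/m\mathbb{Z})^*$ (so $\operatorname{ord}_1(a)=1$), and $\varphi(m)=\#(\mathbb{Z}/m\mathbb{Z})^*$ is Euler's totient. $R^{\eta}$ denotes the direct sum of $\eta$ copies of the ring $R$. Semisimplicity of $\mathcal{C}_{\vec{m}/\mathbb{F}_q}$ is equivalent to all $m_i$ being coprime to $q$. *)

theory Defs
  imports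
    "HOL-Algebra.Algebra"
    "HOL-Algebra.Algebraic_Closure_Type"
    "HOL-Number_Theory.Number_Theory"
    "HOL-Library.Cardinality"
    "HOL-Library.Poly_Mapping"
begin

section \<open>Direct sums of rings, simple and semisimple rings\<close>

text \<open>The direct sum (for finite \<open>I\<close> the same as the direct product) of a family of rings;
  the underlying multiplicative monoid is \<^const>\<open>product_group\<close>.\<close>

definition direct_sum_ring :: "'i set \<Rightarrow> ('i \<Rightarrow> ('a, 'b) ring_scheme) \<Rightarrow> ('i \<Rightarrow> 'a) ring" where
  "direct_sum_ring I S =
     \<lparr> carrier = (\<Pi>\<^sub>E i\<in>I. carrier (S i)),
       monoid.mult = (\<lambda>x y. \<lambda>i\<in>I. x i \<otimes>\<^bsub>S i\<^esub> y i),
       one = (\<lambda>i\<in>I. \<one>\<^bsub>S i\<^esub>),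
       ring.zero = (\<lambda>i\<in>I. \<zero>\<^bsub>S i\<^esub>),
       add = (\<lambda>x y. \<lambda>i\<in>I. x i \<oplus>\<^bsub>S i\<^esub> y i) \<rparr>"

definition simple_ring :: "('a, 'b) ring_scheme \<Rightarrow> bool" where
  "simple_ring R \<longleftrightarrow>
     ring R \<and> carrier R \<noteq> {\<zero>\<^bsub>R\<^esub>} \<and> {J. ideal J R} = {{\<zero>\<^bsub>R\<^esub>}, carrier R}"

lemma simple_ring_iff_field:
  assumes "cring R"
  shows "simple_ring R \<longleftrightarrow> field R"
proof
  assume "simple_ring R"
  then show "field R"
    using cring.trivialideals_eq_field[OF assms] by (simp add: simple_ring_def)
next
  assume F: "field R"
  interpret field R by (rule F)
  have "carrier R \<noteq> {\<zero>\<^bsub>R\<^esub>}"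
    using one_not_zero one_closed by blast
  then show "simple_ring R"
    using all_ideals ring_axioms by (simp add: simple_ring_def)
qed

definition wedderburn_decomposition ::
  "('a, 'b) ring_scheme \<Rightarrow> 'i set \<Rightarrow> ('i \<Rightarrow> ('c, 'd) ring_scheme) \<Rightarrow> bool" where
  "wedderburn_decomposition R I S \<longleftrightarrow>
     finite I \<and> (\<forall>i\<in>I. simple_ring (S i)) \<and> R \<simeq> direct_sum_ring I S"

text \<open>The simple components are looked for among rings over the element type of \<open>R\<close>. This is no
  restriction: any such component is isomorphic to an ideal of \<open>R\<close> (with its own unit).\<close>

definition semisimple_ring :: "('a, 'b) ring_scheme \<Rightarrow> bool" where
  "semisimple_ring R \<longleftrightarrow>
     ring R \<and> (\<exists>(k::nat) (S :: nat \<Rightarrow> 'a ring). wedderburn_decomposition R {..<k} S)"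


section \<open>Circulant rings\<close>

text \<open>A monomial is a finitely supported exponent function on the indices of the variables
  \<open>X\<^sub>0, X\<^sub>1, \<dots>\<close>, and a polynomial is a finitely supported function on monomials.\<close>

type_synonym 'a mpolynomial = "(nat \<Rightarrow>\<^sub>0 nat) \<Rightarrow>\<^sub>0 'a"

definition mvar :: "nat \<Rightarrow> 'a::comm_ring_1 mpolynomial" where
  "mvar i = Poly_Mapping.single (Poly_Mapping.single i 1) 1"

text \<open>The polynomial ring in the \<open>n\<close> variables \<open>X\<^sub>0, \<dots>, X\<^bsub>n-1\<^esub>\<close>.\<close>

definition mpoly_ring :: "nat \<Rightarrow> 'a::comm_ring_1 mpolynomial ring" where
  "mpoly_ring n = ring_of_type_algebra
     \<lparr> carrier := {p. \<forall>s\<in>Poly_Mapping.keys p. Poly_Mapping.keys s \<subseteq> {..<n}} \<rparr>"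

text \<open>Tuples \<open>(m\<^sub>1, \<dots>, m\<^sub>n)\<close> are lists of length \<open>n\<close>, indexed from \<open>0\<close>.\<close>

definition circulant_ring :: "nat list \<Rightarrow> 'a::comm_ring_1 mpolynomial set ring" where
  "circulant_ring ms =
     (let R = mpoly_ring (length ms)
      in R Quot (genideal R {mvar i ^ (ms ! i) - 1 | i. i < length ms}))"


section \<open>The finite field with \<open>q\<^sup>k\<close> elements\<close>

text \<open>Inside a fixed algebraic closure of the ground field \<open>\<bbbF>\<^sub>q\<close> (the type \<open>'a\<close>), the field with
  \<open>q\<^sup>k\<close> elements consists of the roots of \<open>X\<^bsup>q^k\<^esup> - X\<close>.\<close>

definition finite_ext_field :: "nat \<Rightarrow> 'a::finite_field alg_closure ring" where
  "finite_ext_field k = ring_of_type_algebra \<lparr> carrier := {x. x ^ (CARD('a) ^ k) = x} \<rparr>"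

lemma frobenius_CARD_add:
  fixes x y :: "'a::finite_field alg_closure"
  shows "(x + y) ^ CARD('a) = x ^ CARD('a) + y ^ CARD('a)"
proof -
  define q where "q = CARD('a)"
  have q: "q > 1"
    unfolding q_def using card_mono[of UNIV "{0, 1 :: 'a}"] by simp
  have split: "{..q} = insert 0 (insert q {1..<q})"
    using q by auto
  define P :: "'a poly" where "P = (\<Sum>k\<in>{1..<q}. monom (of_nat (q choose k)) k)"
  have "poly P z = 0" for z
  proof -
    have "z + 1 = (z + 1) ^ q"
      unfolding q_def by (simp add: finite_field_power_card_eq_same)
    also have "\<dots> = (\<Sum>k\<le>q. of_nat (q choose k) * z ^ k)"
      by (simp add: binomial_ring)
    also have "\<dots> = 1 + z ^ q + poly P z"
      using q by (simp add: split P_def poly_sum poly_monom)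
    also have "z ^ q = z"
      unfolding q_def by (simp add: finite_field_power_card_eq_same)
    finally show ?thesis by simp
  qed
  then have roots: "{z. poly P z = 0} = UNIV" by auto
  have deg: "degree P < q"
  proof -
    have "degree P \<le> q - 1"
      unfolding P_def by (intro degree_sum_le) (auto intro: order.trans[OF degree_monom_le])
    then show ?thesis using q by simp
  qed
  have "P = 0"
    using card_poly_roots_bound[of P] deg unfolding roots q_def by fastforce
  have choose0: "of_nat (q choose k) = (0 :: 'a)" if "k \<in> {1..<q}" for k
  proof -
    have "coeff P k = (\<Sum>j\<in>{1..<q}. if j = k then of_nat (q choose j) else 0)"
      unfolding P_def by (simp add: coeff_sum)
    also have "\<dots> = of_nat (q choose k)" using that by simp
    finally show ?thesis using \<open>P = 0\<close> by simp
  qed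
  have choose0': "of_nat (q choose k) = (0 :: 'a alg_closure)" if "k \<in> {1..<q}" for k
    using choose0[OF that] by (metis to_ac_0 to_ac_of_nat)
  have "(x + y) ^ q = (\<Sum>k\<le>q. of_nat (q choose k) * x ^ k * y ^ (q - k))"
    by (simp add: binomial_ring)
  also have "\<dots> = x ^ q + y ^ q"
    using q choose0' by (simp add: split)
  finally show ?thesis unfolding q_def .
qed

lemma frobenius_CARD_power_add:
  fixes x y :: "'a::finite_field alg_closure"
  shows "(x + y) ^ (CARD('a) ^ k) = x ^ (CARD('a) ^ k) + y ^ (CARD('a) ^ k)"
proof (induction k)
  case (Suc k)
  then show ?case
    by (simp only: power_Suc2 power_mult frobenius_CARD_add)
qed simp

lemma field_finite_ext_field: "field (finite_ext_field k :: 'a::finite_field alg_closure ring)"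
proof -
  define Q where "Q = CARD('a) ^ k"
  have Q: "Q > 0" unfolding Q_def by simp
  have add: "(x + y) ^ Q = x ^ Q + y ^ Q" for x y :: "'a alg_closure"
    unfolding Q_def by (rule frobenius_CARD_power_add)
  have uminus: "(- x) ^ Q = - (x ^ Q)" for x :: "'a alg_closure"
    using add[of x "- x"] Q by (simp add: eq_neg_iff_add_eq_0 add.commute zero_power)
  have "\<exists>y. y ^ Q = y \<and> x + y = 0" if "x ^ Q = x" for x :: "'a alg_closure"
    using that uminus by (intro exI[of _ "- x"]) auto
  moreover have "\<exists>y. y ^ Q = y \<and> x * y = 1" if "x ^ Q = x" "x \<noteq> 0" for x :: "'a alg_closure"
    using that by (intro exI[of _ "inverse x"]) (auto simp: power_inverse)
  ultimately show ?thesis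
    unfolding finite_ext_field_def Q_def[symmetric] ring_of_type_algebra_def
    using add Q
    by unfold_locales (auto simp: algebra_simps Units_def power_mult_distrib add_eq_0_iff2)
qed

lemma card_finite_ext_field:
  assumes "k > 0"
  shows "card (carrier (finite_ext_field k :: 'a::finite_field alg_closure ring)) = CARD('a) ^ k"
proof -
  define Q where "Q = CARD('a) ^ k"
  have "CARD('a) > 1"
    using card_mono[of UNIV "{0, 1 :: 'a}"] by simp
  then have Q: "Q > 1"
    unfolding Q_def using assms by (intro one_less_power)
  have "CHAR('a alg_closure) dvd Q"
    unfolding Q_def using CHAR_dvd_CARD[where ?'a = 'a] assms
    by (simp add: dvd_power_same dvd_trans[OF _ dvd_power])
  then have Q0: "of_nat Q = (0 :: 'a alg_closure)"
    by (simp only: of_nat_eq_0_iff_char_dvd)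
  define p :: "'a alg_closure poly" where "p = monom 1 Q - monom 1 1"
  have deg: "degree p = Q"
    unfolding p_def diff_conv_add_uminus
    using Q by (subst degree_add_eq_left) (auto simp: degree_monom_eq)
  have nz: "p \<noteq> 0" using deg Q by auto
  have pderiv: "pderiv p = - 1"
    by (simp add: p_def pderiv_diff pderiv_monom Q0 monom_0 flip: one_pCons)
  have order1: "order x p = 1" if "poly p x = 0" for x
  proof (rule ccontr)
    assume "order x p \<noteq> 1"
    moreover have "order x p \<noteq> 0"
      using that nz by (simp add: order_root)
    ultimately have "order x p \<ge> 2" by simp
    then have "[:- x, 1:] ^ 2 dvd p"
      using order_1 power_le_dvd by blast
    then obtain r where "p = [:- x, 1:] ^ 2 * r" by (elim dvdE)
    then have "poly (pderiv p) x = 0"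
      by (simp only: power2_eq_square pderiv_mult poly_add poly_mult) simp
    then show False by (simp add: pderiv)
  qed
  obtain A where A: "size A = degree p" "p = smult (lead_coeff p) (\<Prod>x\<in>#A. [:- x, 1:])"
    using alg_closed_imp_factorization[OF nz] by blast
  have "lead_coeff p \<noteq> 0" using nz by simp
  then have "proots p = proots (\<Prod>x\<in>#A. [:- x, 1:])"
    by (subst A(2)) (rule proots_smult)
  also have "\<dots> = A"
  proof (induction A)
    case (add a B)
    have "(\<Prod>x\<in>#B. [:- x, 1:]) \<noteq> 0"
      by (auto simp: prod_mset_zero_iff)
    then have "proots ([:- a, 1:] * (\<Prod>x\<in>#B. [:- x, 1:])) =
        proots [:- a, 1:] + proots (\<Prod>x\<in>#B. [:- x, 1:])"
      by (intro proots_mult) simp_all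
    then show ?case
      using add.IH by (simp del: mult_pCons_left)
  qed simp
  finally have "size (proots p) = Q"
    using A(1) deg by simp
  moreover have "size (proots p) = (\<Sum>x\<in>{x. poly p x = 0}. order x p)"
    using nz by (simp add: size_multiset_overloaded_eq)
  moreover have "\<dots> = card {x. poly p x = 0}"
    using order1 by simp
  moreover have "{x. poly p x = 0} = carrier (finite_ext_field k :: 'a alg_closure ring)"
    by (auto simp: p_def poly_monom finite_ext_field_def Q_def)
  ultimately show ?thesis unfolding Q_def by simp
qed


section \<open>The index set and the parameters of the decomposition\<close>

definition Div :: "nat list \<Rightarrow> nat list set" where
  "Div ms = {ds. length ds = length ms \<and> (\<forall>i<length ms. ds ! i dvd ms ! i)}"

definition nu :: "nat \<Rightarrow> nat list \<Rightarrow> nat list \<Rightarrow> nat" where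
  "nu q ms ds = (LCM i\<in>{..<length ms}. ord (ms ! i div ds ! i) q)"

text \<open>The division in \<open>eta\<close> is exact when all \<open>m\<^sub>i\<close> are coprime to \<open>q\<close>;
  see \<open>nu_dvd_prod_totient\<close>.\<close>

definition eta :: "nat \<Rightarrow> nat list \<Rightarrow> nat list \<Rightarrow> nat" where
  "eta q ms ds = (\<Prod>i<length ms. totient (ms ! i div ds ! i)) div nu q ms ds"

lemma nu_dvd_prod_totient:
  assumes "\<forall>m\<in>set ms. coprime m q" and "ds \<in> Div ms"
  shows "nu q ms ds dvd (\<Prod>i<length ms. totient (ms ! i div ds ! i))"
  unfolding nu_def
proof (rule Lcm_least)
  fix o' assume "o' \<in> (\<lambda>i. ord (ms ! i div ds ! i) q) ` {..<length ms}"
  then obtain i where i: "i < length ms" and o': "o' = ord (ms ! i div ds ! i) q" by auto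
  have "coprime (ms ! i) q" and "ds ! i dvd ms ! i"
    using assms i by (auto simp: Div_def)
  then have "coprime (ms ! i div ds ! i) q"
    by (metis coprime_mult_left_iff dvd_div_mult_self)
  then have "o' dvd totient (ms ! i div ds ! i)"
    unfolding o' by (simp add: order_divides_totient)
  also have "\<dots> dvd (\<Prod>i<length ms. totient (ms ! i div ds ! i))"
    using i by (intro dvd_prodI) auto
  finally show "o' dvd (\<Prod>i<length ms. totient (ms ! i div ds ! i))" .
qed

end

theory Submission
  imports Defs
begin

text \<open>Let \<open>K\<close> be the algebraic closure and let \<open>Z\<close> be the set of points \<open>x\<close> in \<open>K\<^sup>n\<close> with
  \<open>x\<^sub>i\<^bsup>m\<^esup> = 1\<close> for \<open>m = m\<^sub>i\<close>. Semisimple commutative rings are reduced, which forces every \<open>m\<^sub>i\<close> to be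
  coprime to \<open>q\<close>, so \<open>Z\<close> has \<open>\<Prod> m\<^sub>i\<close> points. The points whose coordinates have the exact orders
  \<open>m\<^sub>i / d\<^sub>i\<close> form \<open>\<eta>(d)\<close> orbits of size \<open>\<nu>(d)\<close> under the \<open>q\<close>-power Frobenius. Evaluation at one
  representative of each orbit maps the polynomial ring into the product of the fields with
  \<open>q\<^bsup>\<nu>(d)\<^esup>\<close> elements. On polynomials of degree less than \<open>m\<^sub>i\<close> in each \<open>X\<^sub>i\<close> it is injective by
  Fourier inversion, hence bijective because both sides have \<open>q\<close> to the power \<open>\<Prod> m\<^sub>i\<close> elements; so
  it is surjective and its kernel is the circulant ideal.\<close>

section \<open>Periods and orbits of a map\<close>

text \<open>Let \<open>e\<close> be the least positive element of \<open>P\<close>. Shifting by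
  \<open>e\<close> preserves \<open>P\<close>, so \<open>P k\<close> depends only on
  \<open>k mod e\<close>, and minimality leaves only the remainder \<open>0\<close>. Applied to the
  exponents \<open>k\<close> with \<open>x ^ k = 1\<close>, this yields the exact order of
  \<open>x\<close>.\<close>

lemma exponents_eq_multiples:
  fixes P :: "nat \<Rightarrow> bool"
  assumes "P N" "N > 0" "\<And>j k. P j \<Longrightarrow> P (j + k) \<longleftrightarrow> P k"
  shows "\<exists>e. \<forall>k. P k \<longleftrightarrow> e dvd k"
proof -
  define e where "e = (LEAST k. k > 0 \<and> P k)"
  have e: "e > 0 \<and> P e"
    unfolding e_def by (rule LeastI[of _ N]) (use assms in auto)
  have min: "k = 0" if "P k" "k < e" for k
    using that not_less_Least[of k "\<lambda>k. k > 0 \<and> P k"] unfolding e_def by auto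
  have step: "P (e * t + k) \<longleftrightarrow> P k" for t k
    using assms(3)[of e] e by (induction t) (auto simp: add.assoc)
  have "P 0"
    using assms(3)[of e 0] e by simp
  have "P k \<longleftrightarrow> e dvd k" for k
  proof -
    have "P k \<longleftrightarrow> P (k mod e)"
      using step[of "k div e" "k mod e"] by simp
    also have "\<dots> \<longleftrightarrow> k mod e = 0"
      using min[of "k mod e"] e \<open>P 0\<close> by auto
    finally show ?thesis by (simp add: dvd_eq_mod_eq_0)
  qed
  then show ?thesis by blast
qed

text \<open>All points of \<open>A\<close> have the same exact period \<open>n\<close>, so the
  orbits partition \<open>A\<close> into blocks of \<open>n\<close> elements. There are
  \<open>card A div n\<close> blocks, and \<open>rep\<close> picks one point from each.\<close>

lemma orbit_representatives:
  fixes f :: "'b \<Rightarrow> 'b" and n :: nat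
  assumes fin: "finite A" and n: "n > 0"
    and closed: "\<And>x. x \<in> A \<Longrightarrow> f x \<in> A"
    and period: "\<And>x k. x \<in> A \<Longrightarrow> (f ^^ k) x = x \<longleftrightarrow> n dvd k"
  shows "\<exists>rep. (\<forall>j < card A div n. rep j \<in> A) \<and>
           (\<forall>x\<in>A. \<exists>j < card A div n. \<exists>k. x = (f ^^ k) (rep j))"
    and "n dvd card A"
proof -
  define orb where "orb x = (\<lambda>k. (f ^^ k) x) ` {..<n}" for x
  have closed': "(f ^^ k) x \<in> A" if "x \<in> A" for x k
    using that closed by (induction k) auto
  have red: "(f ^^ k) x = (f ^^ (k mod n)) x" if "x \<in> A" for x k
  proof -
    have "(f ^^ k) x = (f ^^ (k mod n)) ((f ^^ (n * (k div n))) x)"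
      by (metis comp_apply funpow_add mod_mult_div_eq)
    then show ?thesis using period[OF that, of "n * (k div n)"] by simp
  qed
  have orbI: "(f ^^ k) x \<in> orb x" if "x \<in> A" for x k
    using red[OF that, of k] n unfolding orb_def by auto
  have selfin: "x \<in> orb x" if "x \<in> A" for x
    using orbI[OF that, of 0] by simp
  \<comment> \<open>The exponent \<open>n * k - k\<close> stands for \<open>-k\<close> modulo
    \<open>n\<close>. It involves no truncation because \<open>n > 0\<close>, so iterating
    \<open>f\<close> further inverts \<open>f ^^ k\<close> on \<open>A\<close>.\<close>
  have sym: "x = (f ^^ (n * k - k)) ((f ^^ k) x)" if "x \<in> A" for x k
  proof -
    have "n * k - k + k = n * k" using n by (cases n) auto
    then have "(f ^^ (n * k - k)) ((f ^^ k) x) = (f ^^ (n * k)) x"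
      by (metis comp_apply funpow_add)
    then show ?thesis using period[OF that, of "n * k"] by simp
  qed
  have card_orb: "card (orb x) = n" if x: "x \<in> A" for x
  proof -
    have "j = k" if eq: "(f ^^ j) x = (f ^^ k) x" and jk: "j < n" "k < n" for j k
    proof -
      have "x = (f ^^ (n * j - j)) ((f ^^ k) x)"
        using sym[OF x, of j] eq by simp
      then have "(f ^^ (n * j - j + k)) x = x"
        by (simp add: funpow_add)
      then have "n dvd n * j - j + k" using period[OF x] by simp
      then have "[n * j - j + k = 0] (mod n)" by (simp add: cong_0_iff)
      then have "[n * j - j + k + j = 0 + j] (mod n)" by (rule cong_add) simp
      moreover have "n * j - j + k + j = n * j + k" using n by (cases n) auto
      ultimately have "[k = j] (mod n)" by (simp add: cong_def)
      then show ?thesis using jk by (simp add: cong_def)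
    qed
    then have "inj_on (\<lambda>k. (f ^^ k) x) {..<n}" by (auto intro: inj_onI)
    then show ?thesis unfolding orb_def by (simp add: card_image)
  qed
  have sub: "orb x \<subseteq> orb y" if xy: "x \<in> A" "y \<in> A" and "orb x \<inter> orb y \<noteq> {}" for x y
  proof -
    obtain j k where "(f ^^ j) x = (f ^^ k) y"
      using \<open>orb x \<inter> orb y \<noteq> {}\<close> unfolding orb_def by blast
    then have "x = (f ^^ (n * j - j + k)) y"
      using sym[OF xy(1), of j] by (simp add: funpow_add)
    then have "(f ^^ i) x = (f ^^ (i + (n * j - j + k))) y" for i
      by (metis comp_apply funpow_add)
    then show ?thesis
      using orbI[OF xy(2)] unfolding orb_def[of x] by auto
  qed
  have disj: "c1 \<inter> c2 = {}" if "c1 \<in> orb ` A" "c2 \<in> orb ` A" "c1 \<noteq> c2" for c1 c2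
    using that sub by (metis (no_types, lifting) Int_commute imageE subset_antisym)
  have un: "\<Union>(orb ` A) = A"
    using selfin closed' by (auto simp: orb_def)
  have "n * card (orb ` A) = card (\<Union>(orb ` A))"
    by (rule card_partition) (use fin card_orb disj un in auto)
  then have card: "n * card (orb ` A) = card A" unfolding un .
  then show "n dvd card A" by (metis dvd_triv_left)
  have "card (orb ` A) = card A div n" using card n by (metis nonzero_mult_div_cancel_left not_less0)
  moreover obtain g where "bij_betw g {..<card (orb ` A)} (orb ` A)"
    using ex_bij_betw_nat_finite[of "orb ` A"] fin by (auto simp: atLeast0LessThan)
  ultimately have g: "g ` {..<card A div n} = orb ` A"
    by (simp add: bij_betw_def)
  have "\<forall>j. \<exists>y. j < card A div n \<longrightarrow> y \<in> A \<and> g j = orb y"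
    using g by blast
  then obtain rep where rep: "\<And>j. j < card A div n \<Longrightarrow> rep j \<in> A \<and> g j = orb (rep j)"
    by metis
  have "\<exists>j < card A div n. \<exists>k. x = (f ^^ k) (rep j)" if x: "x \<in> A" for x
  proof -
    obtain j where j: "j < card A div n" "g j = orb x"
      using g x by (metis (no_types, lifting) imageE image_eqI lessThan_iff)
    then have "x \<in> orb (rep j)" using selfin[OF x] rep by simp
    then show ?thesis using j(1) unfolding orb_def by blast
  qed
  then show "\<exists>rep. (\<forall>j < card A div n. rep j \<in> A) \<and>
           (\<forall>x\<in>A. \<exists>j < card A div n. \<exists>k. x = (f ^^ k) (rep j))"
    using rep by blast
qed

section \<open>Roots of unity in the algebraic closure\<close>

definition unity_roots :: "nat \<Rightarrow> 'b::comm_ring_1 set" where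
  "unity_roots m = {x. x ^ m = 1}"

text \<open>Elements of exact order \<open>e\<close>, phrased through divisibility of exponents so
  that no group of units has to be formed.\<close>

definition primitive_roots :: "nat \<Rightarrow> 'b::comm_ring_1 set" where
  "primitive_roots e = {x. \<forall>k. x ^ k = 1 \<longleftrightarrow> e dvd k}"

lemma card_unity_roots_le:
  assumes "m > 0"
  shows "finite (unity_roots m :: 'b::field set)" "card (unity_roots m :: 'b::field set) \<le> m"
proof -
  define p :: "'b poly" where "p = monom 1 m - 1"
  have deg: "degree p = m"
    unfolding p_def diff_conv_add_uminus
    using assms by (subst degree_add_eq_left) (auto simp: degree_monom_eq)
  then have nz: "p \<noteq> 0" using assms by auto
  have *: "unity_roots m = {x. poly p x = 0}"
    by (auto simp: unity_roots_def p_def poly_monom)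
  show "finite (unity_roots m :: 'b set)"
    unfolding * using nz by (rule poly_roots_finite)
  show "card (unity_roots m :: 'b set) \<le> m"
    unfolding * using card_poly_roots_bound[OF nz] deg by simp
qed

lemma CARD_finite_field_gt_1: "CARD('a::finite_field) > 1"
  using card_mono[of UNIV "{0, 1 :: 'a}"] by simp

text \<open>Among the \<open>N = q\<^bsup>k\<^esup> - 1 = m r\<close> roots of \<open>X\<^bsup>N\<^esup> - 1 = (X\<^bsup>m\<^esup> - 1) S\<close>, at most \<open>N - m\<close> are roots of \<open>S\<close>.\<close>

lemma card_unity_roots:
  assumes m: "m > 0" and cop: "coprime m CARD('a::finite_field)"
  shows "card (unity_roots m :: 'a alg_closure set) = m"
proof -
  define q where "q = CARD('a)"
  have q: "q > 1" unfolding q_def by (rule CARD_finite_field_gt_1)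
  define k where "k = ord m q"
  have k: "k > 0" using cop ord_eq_0[of m q] unfolding k_def q_def by auto
  have "[q ^ k = 1] (mod m)" unfolding k_def by (rule ord)
  then have "m dvd q ^ k - 1"
    by (metis cong_to_1_nat)
  then obtain r where r: "q ^ k - 1 = m * r" by blast
  have qk: "q ^ k > 1" using q k by (rule one_less_power)
  then have r0: "r > 0" using r by (cases r) auto
  define U :: "'a alg_closure set" where "U = unity_roots (m * r)"
  \<comment> \<open>The nonzero elements of the field with \<open>q ^ k\<close> elements are the
    roots of \<open>x ^ (m * r) = 1\<close>, so the known size of that field gives
    \<open>card U\<close>.\<close>
  have "carrier (finite_ext_field k :: 'a alg_closure ring) = insert 0 U"
  proof -
    have *: "q ^ k = Suc (m * r)" using r qk by simp
    have "x ^ (q ^ k) = x \<longleftrightarrow> x = 0 \<or> x ^ (m * r) = 1" for x :: "'a alg_closure"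
      unfolding * by auto
    then show ?thesis
      by (auto simp: finite_ext_field_def U_def unity_roots_def q_def)
  qed
  moreover have "finite U" unfolding U_def by (rule card_unity_roots_le) (use m r0 in simp)
  moreover have "0 \<notin> U" using m r0 by (auto simp: U_def unity_roots_def zero_power)
  ultimately have cardU: "card U = m * r"
    using card_finite_ext_field[OF k, where ?'a = 'a] r unfolding q_def by simp
  define S :: "'a alg_closure poly" where "S = (\<Sum>i<r. monom 1 (m * i))"
  have S: "(x ^ m - 1) * poly S x = x ^ (m * r) - 1" for x
    by (simp add: S_def poly_sum poly_monom power_diff_1_eq power_mult)
  have "coeff S 0 = (\<Sum>i<r. if i = 0 then 1 else 0)"
    unfolding S_def coeff_sum using m by (intro sum.cong) auto
  then have "coeff S 0 = 1" using r0 by simp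
  then have S0: "S \<noteq> 0" by auto
  have degS: "degree S \<le> m * (r - 1)"
  proof -
    have "m * i \<le> m * (r - 1)" if "i < r" for i
      using that by (intro mult_left_mono) auto
    then show ?thesis
      unfolding S_def by (intro degree_sum_le) (auto intro!: order.trans[OF degree_monom_le])
  qed
  have "U \<subseteq> unity_roots m \<union> {x. poly S x = 0}"
  proof
    fix x assume "x \<in> U"
    then have "(x ^ m - 1) * poly S x = 0" unfolding S by (simp add: U_def unity_roots_def)
    then show "x \<in> unity_roots m \<union> {x. poly S x = 0}" by (simp add: unity_roots_def)
  qed
  then have "card U \<le> card (unity_roots m \<union> {x. poly S x = 0})"
    by (intro card_mono) (simp_all add: card_unity_roots_le m poly_roots_finite S0)
  also have "\<dots> \<le> card (unity_roots m :: 'a alg_closure set) + card {x. poly S x = 0}"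
    by (rule card_Un_le)
  also have "\<dots> \<le> card (unity_roots m :: 'a alg_closure set) + m * (r - 1)"
    using card_poly_roots_bound[OF S0] degS by simp
  finally have "m * r \<le> card (unity_roots m :: 'a alg_closure set) + m * (r - 1)"
    unfolding cardU .
  moreover have "m * r = m + m * (r - 1)" using r0 by (cases r) auto
  ultimately have "m \<le> card (unity_roots m :: 'a alg_closure set)" by simp
  then show ?thesis using card_unity_roots_le(2)[OF m] by (metis le_antisym)
qed

text \<open>The exponents \<open>k\<close> with \<open>x ^ k = 1\<close> satisfy the shift condition
  of \<open>exponents_eq_multiples\<close>, and \<open>m\<close> is one of them. Hence
  \<open>x\<close> has an exact order, and this order divides \<open>m\<close>.\<close>

lemma unity_roots_eq_Union_primitive_roots:
  assumes "m > 0"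
  shows "unity_roots m = (\<Union>e\<in>{e. e dvd m}. primitive_roots e :: 'b::field set)"
proof -
  have "\<exists>e. e dvd m \<and> x \<in> primitive_roots e" if "x ^ m = 1" for x :: 'b
  proof -
    have "\<exists>e. \<forall>k. x ^ k = 1 \<longleftrightarrow> e dvd k"
      by (rule exponents_eq_multiples[of _ m]) (use that assms in \<open>auto simp: power_add\<close>)
    then show ?thesis using that by (auto simp: primitive_roots_def)
  qed
  then show ?thesis
    by (auto simp: unity_roots_def primitive_roots_def)
qed

lemma primitive_roots_unique:
  assumes "x \<in> primitive_roots d" "x \<in> primitive_roots e"
  shows "d = e"
proof -
  have "d dvd k \<longleftrightarrow> e dvd k" for k
    using assms by (simp add: primitive_roots_def)
  then show ?thesis by (metis dvd_antisym dvd_refl)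
qed

text \<open>The number of primitive roots and \<open>totient\<close>, summed over the divisors of
  \<open>m\<close>, both give \<open>m\<close>. By strong induction the terms of the proper divisors
  agree, so the terms at \<open>m\<close> agree too.\<close>

lemma card_primitive_roots:
  assumes "m > 0" and "coprime m CARD('a::finite_field)"
  shows "card (primitive_roots m :: 'a alg_closure set) = totient m"
  using assms
proof (induction m rule: less_induct)
  case (less m)
  define D where "D = {d. d dvd m} - {m}"
  have D: "{d. d dvd m} = insert m D" "m \<notin> D" "finite D"
    using less.prems(1) by (auto simp: D_def)
  have fin: "finite (primitive_roots e :: 'a alg_closure set)" if "e dvd m" for e
    using card_unity_roots_le(1)[OF less.prems(1), where ?'b = "'a alg_closure"] that
    using unity_roots_eq_Union_primitive_roots[OF less.prems(1), where ?'b = "'a alg_closure"]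
    by (metis (no_types, lifting) UN_upper finite_subset mem_Collect_eq)
  have IH: "card (primitive_roots d :: 'a alg_closure set) = totient d" if "d \<in> D" for d
  proof (rule less.IH)
    have "d dvd m" "d \<noteq> m" using that by (auto simp: D_def)
    then show "d < m" using less.prems(1) dvd_imp_le[of d m] by simp
    show "d > 0" using \<open>d dvd m\<close> less.prems(1) by (rule dvd_pos_nat[rotated])
    show "coprime d CARD('a)"
      using coprime_divisors[OF \<open>d dvd m\<close> dvd_refl less.prems(2)] .
  qed
  have "m = card (unity_roots m :: 'a alg_closure set)"
    using less.prems by (simp add: card_unity_roots)
  also have "\<dots> = (\<Sum>e\<in>{d. d dvd m}. card (primitive_roots e :: 'a alg_closure set))"
    unfolding unity_roots_eq_Union_primitive_roots[OF less.prems(1)]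
    by (rule card_UN_disjoint) (use fin less.prems(1) primitive_roots_unique in \<open>auto simp: finite_divisors_nat\<close>)
  also have "\<dots> = card (primitive_roots m :: 'a alg_closure set) + (\<Sum>e\<in>D. totient e)"
    unfolding D(1) using D(2,3) IH by (simp only: sum.insert not_False_eq_True cong: sum.cong)
  finally have "m = card (primitive_roots m :: 'a alg_closure set) + (\<Sum>e\<in>D. totient e)" .
  moreover have "totient m + (\<Sum>e\<in>D. totient e) = m"
    using totient_divisor_sum[of m] D(2,3) unfolding D(1) by (simp only: sum.insert not_False_eq_True)
  ultimately show ?case by linarith
qed

text \<open>Orthogonality of characters of a cyclic group. If \<open>m\<close> does not divide
  \<open>j\<close>, multiplication by a primitive root \<open>w\<close> permutes the roots of unity
  and scales the sum by \<open>w ^ j \<noteq> 1\<close>, so the sum is \<open>0\<close>.\<close>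

lemma sum_unity_roots_power:
  assumes m: "m > 0" and cop: "coprime m CARD('a::finite_field)"
  shows "(\<Sum>z\<in>unity_roots m. z ^ j) = (if m dvd j then of_nat m else (0 :: 'a alg_closure))"
proof (cases "m dvd j")
  case True
  then obtain k where j: "j = m * k" by blast
  have "(\<Sum>z\<in>unity_roots m. z ^ j) = (\<Sum>z\<in>(unity_roots m :: 'a alg_closure set). 1 :: 'a alg_closure)"
    by (rule sum.cong) (simp_all add: j unity_roots_def power_mult)
  then show ?thesis using True card_unity_roots[OF assms] by simp
next
  case False
  have "primitive_roots m \<noteq> ({} :: 'a alg_closure set)"
    using card_primitive_roots[OF assms] m by (metis card.empty not_less0 totient_gt_0_iff)
  then obtain w :: "'a alg_closure" where w: "w \<in> primitive_roots m" by blast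
  have wj: "w ^ j \<noteq> 1" and wm: "w ^ m = 1" using w False by (auto simp: primitive_roots_def)
  have w0: "w \<noteq> 0" using wm m by (auto simp: zero_power)
  have "bij_betw (\<lambda>z. w * z) (unity_roots m) (unity_roots m)"
    by (rule bij_betwI[where g = "\<lambda>z. z / w"])
      (simp_all add: Pi_def unity_roots_def power_mult_distrib power_divide wm w0)
  from sum.reindex_bij_betw[OF this, of "\<lambda>z. z ^ j"]
  have "(\<Sum>z\<in>unity_roots m. z ^ j) = (\<Sum>z\<in>unity_roots m. (w * z) ^ j)"
    by (rule sym)
  also have "\<dots> = w ^ j * (\<Sum>z\<in>unity_roots m. z ^ j)"
    by (simp add: power_mult_distrib sum_distrib_left)
  finally have eq: "(\<Sum>z\<in>unity_roots m. z ^ j) = w ^ j * (\<Sum>z\<in>unity_roots m. z ^ j)" .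
  have "(\<Sum>z\<in>unity_roots m. z ^ j) = (0 :: 'a alg_closure)"
    using eq[symmetric] wj by simp
  then show ?thesis using False by simp
qed

text \<open>The characteristic divides the number of elements of the field, so it cannot divide a
  number coprime to that.\<close>

lemma of_nat_neq_0_if_coprime_CARD:
  assumes "coprime m CARD('a::finite_field)"
  shows "of_nat m \<noteq> (0 :: 'a alg_closure)"
proof
  assume "of_nat m = (0 :: 'a alg_closure)"
  then have "of_nat m = (0 :: 'a)" by (metis to_ac_eq_0_iff to_ac_of_nat)
  then have "CHAR('a) dvd m" by (simp add: of_nat_eq_0_iff_char_dvd)
  then have "CHAR('a) dvd 1" using assms CHAR_dvd_CARD[where ?'a = 'a] by (metis coprime_common_divisor)
  then show False using CHAR_prime[where ?'a = 'a] by (simp add: not_prime_1)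
qed

text \<open>Write \<open>q\<close> for \<open>CARD('a)\<close>. If \<open>p\<close> were nonzero in
  the field, take a root \<open>z\<close> of \<open>1 + X + ... + X^(p-1)\<close>. Then
  \<open>z ^ q = 1\<close>, and additivity of the \<open>q\<close>-th power gives
  \<open>(z - 1) ^ q = 0\<close>, so \<open>z = 1\<close>. But the polynomial takes the value
  \<open>p\<close> at \<open>1\<close>, a contradiction.\<close>

lemma prime_dvd_CARD_finite_field:
  assumes p: "Factorial_Ring.prime p" and dvd: "p dvd CARD('a::finite_field)"
  shows "p = CHAR('a)"
proof -
  have dream: "(x - 1) ^ CARD('a) = x ^ CARD('a) - 1" for x :: "'a alg_closure"
    using frobenius_CARD_add[of "x - 1" 1] by simp
  have "of_nat p = (0 :: 'a alg_closure)"
  proof (rule ccontr)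
    assume np: "of_nat p \<noteq> (0 :: 'a alg_closure)"
    define S :: "'a alg_closure poly" where "S = (\<Sum>i<p. monom 1 i)"
    have "coeff S (p - 1) = 1"
      unfolding S_def coeff_sum using prime_gt_0_nat[OF p] by simp
    moreover have "p - 1 > 0" using prime_gt_1_nat[OF p] by simp
    ultimately have "degree S > 0"
      by (metis le_degree less_le_trans zero_neq_one)
    then obtain z where z: "poly S z = 0" using alg_closed_imp_poly_has_root by blast
    have "z ^ p - 1 = (z - 1) * poly S z"
      by (simp add: S_def poly_sum poly_monom power_diff_1_eq)
    then have "z ^ p = 1" using z by simp
    moreover obtain r where "CARD('a) = p * r" using dvd by blast
    ultimately have "z ^ CARD('a) = 1" by (simp add: power_mult)
    then have "(z - 1) ^ CARD('a) = 0" by (simp only: dream) simp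
    then have "z = 1" by simp
    then show False using z np by (simp add: S_def poly_sum poly_monom)
  qed
  then have "of_nat p = (0 :: 'a)" by (metis to_ac_eq_0_iff to_ac_of_nat)
  then have "CHAR('a) dvd p" by (simp add: of_nat_eq_0_iff_char_dvd)
  then show ?thesis using p CHAR_prime[where ?'a = 'a] by (metis primes_dvd_imp_eq)
qed

section \<open>Evaluation of polynomials and reduction modulo the circulant ideal\<close>

lemma sum_single_lookup:
  fixes p :: "'b \<Rightarrow>\<^sub>0 'c::comm_monoid_add"
  shows "(\<Sum>s\<in>Poly_Mapping.keys p. Poly_Mapping.single s (Poly_Mapping.lookup p s)) = p"
proof (rule poly_mapping_eqI)
  fix k
  have "Poly_Mapping.lookup (\<Sum>s\<in>Poly_Mapping.keys p. Poly_Mapping.single s (Poly_Mapping.lookup p s)) k =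
      (\<Sum>s\<in>Poly_Mapping.keys p. if s = k then Poly_Mapping.lookup p k else 0)"
    unfolding lookup_sum by (intro sum.cong) (auto simp: lookup_single)
  also have "\<dots> = Poly_Mapping.lookup p k"
    by (simp add: in_keys_iff)
  finally show "Poly_Mapping.lookup (\<Sum>s\<in>Poly_Mapping.keys p. Poly_Mapping.single s (Poly_Mapping.lookup p s)) k =
      Poly_Mapping.lookup p k" .
qed

lemma mvar_power: "mvar i ^ k = Poly_Mapping.single (Poly_Mapping.single i k) (1 :: 'a::comm_ring_1)"
proof (induction k)
  case (Suc k)
  have "Poly_Mapping.single i (Suc 0) + Poly_Mapping.single i k = Poly_Mapping.single i (Suc k)"
    by (simp flip: single_add)
  then show ?case
    unfolding power_Suc Suc by (simp add: mvar_def mult_single)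
qed simp

text \<open>One evaluation theory serves two coefficient maps: the embedding \<open>to_ac\<close>
  into the algebraic closure, and the constants \<open>[:a:]\<close> inside the univariate
  polynomials.\<close>

locale coefficient_hom =
  fixes \<phi> :: "'a::comm_ring_1 \<Rightarrow> 'b::comm_ring_1"
  assumes hom_add: "\<phi> (a + b) = \<phi> a + \<phi> b"
    and hom_mult: "\<phi> (a * b) = \<phi> a * \<phi> b"
    and hom_1: "\<phi> 1 = 1"
begin

lemma hom_0: "\<phi> 0 = 0"
  using hom_add[of 0 0] by simp

text \<open>Stopping the product at \<open>n\<close> amounts to setting every variable of index at
  least \<open>n\<close> to \<open>1\<close>, so \<open>insertion\<close> is a homomorphism on the
  whole type of polynomials.\<close>

definition monomial_value :: "nat \<Rightarrow> (nat \<Rightarrow> 'b) \<Rightarrow> (nat \<Rightarrow>\<^sub>0 nat) \<Rightarrow> 'b" where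
  "monomial_value n x s = (\<Prod>i<n. x i ^ Poly_Mapping.lookup s i)"

definition insertion :: "nat \<Rightarrow> (nat \<Rightarrow> 'b) \<Rightarrow> 'a mpolynomial \<Rightarrow> 'b" where
  "insertion n x p =
     (\<Sum>s\<in>Poly_Mapping.keys p. \<phi> (Poly_Mapping.lookup p s) * monomial_value n x s)"

text \<open>The extra terms have coefficient \<open>0\<close>, which \<open>\<phi>\<close> maps to
  \<open>0\<close>. This puts several polynomials over one common index set.\<close>

lemma insertion_superset:
  assumes "finite A" "Poly_Mapping.keys p \<subseteq> A"
  shows "insertion n x p = (\<Sum>s\<in>A. \<phi> (Poly_Mapping.lookup p s) * monomial_value n x s)"
  unfolding insertion_def
  by (rule sum.mono_neutral_left) (use assms in \<open>auto simp: in_keys_iff hom_0\<close>)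

lemma insertion_single: "insertion n x (Poly_Mapping.single s a) = \<phi> a * monomial_value n x s"
  by (subst insertion_superset[of "{s}"]) auto

lemma insertion_add: "insertion n x (p + q) = insertion n x p + insertion n x q"
proof -
  define A where "A = Poly_Mapping.keys p \<union> Poly_Mapping.keys q"
  have A: "finite A" "Poly_Mapping.keys p \<subseteq> A" "Poly_Mapping.keys q \<subseteq> A"
      "Poly_Mapping.keys (p + q) \<subseteq> A"
    unfolding A_def using Poly_Mapping.keys_add[of p q] by auto
  show ?thesis
    by (simp only: insertion_superset[OF A(1)] A(2-4) lookup_add hom_add distrib_right sum.distrib)
qed

lemma insertion_0: "insertion n x 0 = 0"
  by (simp add: insertion_def)

lemma insertion_sum: "insertion n x (sum f A) = (\<Sum>i\<in>A. insertion n x (f i))"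
  by (induction A rule: infinite_finite_induct) (auto simp: insertion_0 insertion_add)

lemma insertion_minus: "insertion n x (p - q) = insertion n x p - insertion n x q"
  using insertion_add[of n x "p - q" q] by (simp add: eq_diff_eq)

lemma monomial_value_0: "monomial_value n x 0 = 1"
  by (simp add: monomial_value_def)

lemma monomial_value_add: "monomial_value n x (s + t) = monomial_value n x s * monomial_value n x t"
  by (simp add: monomial_value_def lookup_add power_add prod.distrib)

lemma insertion_1: "insertion n x 1 = 1"
  using insertion_single[of n x 0 1] by (simp add: hom_1 monomial_value_0)

text \<open>Both factors are expanded into single terms, on which evaluation is multiplicative by
  \<open>hom_mult\<close> and \<open>monomial_value_add\<close>; additivity does the rest.\<close>

lemma insertion_mult: "insertion n x (p * q) = insertion n x p * insertion n x q"
proof -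
  have "p * q =
      (\<Sum>s\<in>Poly_Mapping.keys p. Poly_Mapping.single s (Poly_Mapping.lookup p s)) *
      (\<Sum>t\<in>Poly_Mapping.keys q. Poly_Mapping.single t (Poly_Mapping.lookup q t))"
    by (simp only: sum_single_lookup)
  also have "\<dots> = (\<Sum>s\<in>Poly_Mapping.keys p. \<Sum>t\<in>Poly_Mapping.keys q.
      Poly_Mapping.single (s + t) (Poly_Mapping.lookup p s * Poly_Mapping.lookup q t))"
    by (simp only: sum_product mult_single)
  finally show ?thesis
    by (simp add: insertion_sum insertion_single hom_mult monomial_value_add insertion_def[of n x p]
        insertion_def[of n x q] sum_product mult_ac)
qed

lemma insertion_power: "insertion n x (p ^ k) = insertion n x p ^ k"
  by (induction k) (simp_all add: insertion_1 insertion_mult)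

lemma insertion_mvar:
  assumes "i < n"
  shows "insertion n x (mvar i) = x i"
proof -
  have "monomial_value n x (Poly_Mapping.single i 1) = (\<Prod>j<n. if j = i then x i else 1)"
    unfolding monomial_value_def by (intro prod.cong) (auto simp: lookup_single)
  then show ?thesis
    using assms by (simp add: mvar_def insertion_single hom_1)
qed

end

section \<open>The polynomial ring and the circulant ideal\<close>

lemma mpoly_ring_simps [simp]:
  "\<zero>\<^bsub>mpoly_ring n\<^esub> = 0" "\<one>\<^bsub>mpoly_ring n\<^esub> = 1"
  "p \<oplus>\<^bsub>mpoly_ring n\<^esub> q = p + q" "p \<otimes>\<^bsub>mpoly_ring n\<^esub> q = p * q"
  by (simp_all add: mpoly_ring_def ring_of_type_algebra_def)

lemma mem_mpoly_ring:
  "p \<in> carrier (mpoly_ring n) \<longleftrightarrow> (\<forall>s\<in>Poly_Mapping.keys p. Poly_Mapping.keys s \<subseteq> {..<n})"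
  by (simp add: mpoly_ring_def)

lemma mpoly_ring_closed:
  shows "p \<in> carrier (mpoly_ring n) \<Longrightarrow> q \<in> carrier (mpoly_ring n) \<Longrightarrow> p + q \<in> carrier (mpoly_ring n)"
    and "p \<in> carrier (mpoly_ring n) \<Longrightarrow> q \<in> carrier (mpoly_ring n) \<Longrightarrow> p * q \<in> carrier (mpoly_ring n)"
    and "p \<in> carrier (mpoly_ring n) \<Longrightarrow> - p \<in> carrier (mpoly_ring n)"
    and "0 \<in> carrier (mpoly_ring n)"
    and "1 \<in> carrier (mpoly_ring n)"
    and "i < n \<Longrightarrow> mvar i \<in> carrier (mpoly_ring n)"
    and "Poly_Mapping.keys s \<subseteq> {..<n} \<Longrightarrow> Poly_Mapping.single s a \<in> carrier (mpoly_ring n)"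
proof -
  assume p: "p \<in> carrier (mpoly_ring n)" and q: "q \<in> carrier (mpoly_ring n)"
  show "p + q \<in> carrier (mpoly_ring n)"
    using p q Poly_Mapping.keys_add[of p q] unfolding mem_mpoly_ring by blast
  show "p * q \<in> carrier (mpoly_ring n)"
    unfolding mem_mpoly_ring
  proof
    fix s assume "s \<in> Poly_Mapping.keys (p * q)"
    then obtain u v where s: "s = u + v" "u \<in> Poly_Mapping.keys p" "v \<in> Poly_Mapping.keys q"
      using keys_mult[of p q] by blast
    then show "Poly_Mapping.keys s \<subseteq> {..<n}"
      using p q Poly_Mapping.keys_add[of u v] unfolding mem_mpoly_ring by blast
  qed
qed (auto simp: mem_mpoly_ring in_keys_iff mvar_def lookup_single when_def split: if_splits)

lemma cring_mpoly_ring: "cring (mpoly_ring n :: 'a::comm_ring_1 mpolynomial ring)"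
proof -
  have "\<exists>q\<in>carrier (mpoly_ring n). p + q = 0"
    if "p \<in> carrier (mpoly_ring n)" for p :: "'a mpolynomial"
    using that mpoly_ring_closed(3) by (intro bexI[of _ "- p"]) auto
  then show ?thesis
    by unfold_locales (auto simp: mpoly_ring_closed algebra_simps Units_def add_eq_0_iff2)
qed

lemma mpoly_ring_pow: "p [^]\<^bsub>mpoly_ring n\<^esub> (k::nat) = p ^ k"
  by (induction k) (simp_all add: monoid.nat_pow_0 nat_pow_def mult.commute)

lemma mpoly_ring_closed_power:
  "p \<in> carrier (mpoly_ring n) \<Longrightarrow> p ^ k \<in> carrier (mpoly_ring n)"
  by (induction k) (simp_all add: mpoly_ring_closed)

lemma mpoly_ring_closed_diff:
  "p \<in> carrier (mpoly_ring n) \<Longrightarrow> q \<in> carrier (mpoly_ring n) \<Longrightarrow> p - q \<in> carrier (mpoly_ring n)"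
  unfolding diff_conv_add_uminus by (intro mpoly_ring_closed)

definition circulant_ideal :: "nat list \<Rightarrow> 'a::comm_ring_1 mpolynomial set" where
  "circulant_ideal ms =
     genideal (mpoly_ring (length ms)) {mvar i ^ (ms ! i) - 1 | i. i < length ms}"

lemma circulant_ring_eq:
  "circulant_ring ms = mpoly_ring (length ms) Quot circulant_ideal ms"
  by (simp add: circulant_ring_def circulant_ideal_def Let_def)

lemma circulant_gens_closed:
  "{mvar i ^ (ms ! i) - 1 | i. i < length ms} \<subseteq> carrier (mpoly_ring (length ms))"
  by (auto intro!: mpoly_ring_closed_diff mpoly_ring_closed_power mpoly_ring_closed)

lemma ideal_circulant_ideal: "ideal (circulant_ideal ms) (mpoly_ring (length ms))"
  unfolding circulant_ideal_def
  by (intro ring.genideal_ideal cring.axioms(1) cring_mpoly_ring circulant_gens_closed)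

lemma circulant_ideal_gen:
  "i < length ms \<Longrightarrow> mvar i ^ (ms ! i) - 1 \<in> circulant_ideal ms"
  unfolding circulant_ideal_def
  using ring.genideal_self[OF cring.axioms(1)[OF cring_mpoly_ring] circulant_gens_closed] by blast

lemma circulant_ideal_minimal:
  assumes "ideal I (mpoly_ring (length ms))"
    and "\<And>i. i < length ms \<Longrightarrow> mvar i ^ (ms ! i) - 1 \<in> I"
  shows "circulant_ideal ms \<subseteq> I"
  unfolding circulant_ideal_def
  by (intro ring.genideal_minimal cring.axioms(1) cring_mpoly_ring) (use assms in auto)

lemma circulant_ideal_closed:
  shows "p \<in> circulant_ideal ms \<Longrightarrow> q \<in> circulant_ideal ms \<Longrightarrow> p + q \<in> circulant_ideal ms"
    and "0 \<in> circulant_ideal ms"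
    and "p \<in> carrier (mpoly_ring (length ms)) \<Longrightarrow> q \<in> circulant_ideal ms \<Longrightarrow> p * q \<in> circulant_ideal ms"
proof -
  interpret ideal "circulant_ideal ms" "mpoly_ring (length ms)" by (rule ideal_circulant_ideal)
  show "p \<in> circulant_ideal ms \<Longrightarrow> q \<in> circulant_ideal ms \<Longrightarrow> p + q \<in> circulant_ideal ms"
    using additive_subgroup.a_closed[OF ideal.axioms(1)[OF ideal_circulant_ideal], of p ms q] by simp
  show "0 \<in> circulant_ideal ms"
    using additive_subgroup.zero_closed[OF ideal.axioms(1)[OF ideal_circulant_ideal], of ms] by simp
  show "p \<in> carrier (mpoly_ring (length ms)) \<Longrightarrow> q \<in> circulant_ideal ms \<Longrightarrow> p * q \<in> circulant_ideal ms"
    using I_l_closed[of q p] by simp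
qed

section \<open>Normal forms modulo the circulant ideal and their number\<close>

definition reduced_monomials :: "nat list \<Rightarrow> (nat \<Rightarrow>\<^sub>0 nat) set" where
  "reduced_monomials ms = {s. Poly_Mapping.keys s \<subseteq> {..<length ms} \<and>
     (\<forall>i<length ms. Poly_Mapping.lookup s i < ms ! i)}"

text \<open>Lowering an exponent of variable \<open>i\<close> by \<open>ms ! i\<close> changes the
  term by a multiple of the generator \<open>mvar i ^ (ms ! i) - 1\<close>. The total degree drops
  since \<open>ms ! i > 0\<close>, so the process ends at a reduced monomial.\<close>

lemma monomial_reduction:
  assumes pos: "\<forall>m\<in>set ms. m > 0" and s: "Poly_Mapping.keys s \<subseteq> {..<length ms}"
  shows "\<exists>t\<in>reduced_monomials ms.
    Poly_Mapping.single s a - Poly_Mapping.single t a \<in> (circulant_ideal ms :: 'a::comm_ring_1 mpolynomial set)"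
  using s
proof (induction "\<Sum>i<length ms. Poly_Mapping.lookup s i" arbitrary: s rule: less_induct)
  case less
  show ?case
  proof (cases "s \<in> reduced_monomials ms")
    case True
    then show ?thesis by (intro bexI[of _ s]) (simp_all add: circulant_ideal_closed)
  next
    case False
    then obtain i where i: "i < length ms" "ms ! i \<le> Poly_Mapping.lookup s i"
      using less.prems by (auto simp: reduced_monomials_def not_less)
    define t where "t = s - Poly_Mapping.single i (ms ! i)"
    have st: "s = t + Poly_Mapping.single i (ms ! i)"
      unfolding t_def using i(2)
      by (intro poly_mapping_eqI) (auto simp: lookup_add lookup_minus lookup_single when_def)
    have t: "Poly_Mapping.keys t \<subseteq> {..<length ms}"
    proof
      fix j assume "j \<in> Poly_Mapping.keys t"
      then have "j \<in> Poly_Mapping.keys s" by (simp add: st in_keys_iff lookup_add)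
      then show "j \<in> {..<length ms}" using less.prems by blast
    qed
    have "(\<Sum>j<length ms. Poly_Mapping.lookup t j) < (\<Sum>j<length ms. Poly_Mapping.lookup s j)"
    proof (rule sum_strict_mono_ex1)
      show "\<exists>j\<in>{..<length ms}. Poly_Mapping.lookup t j < Poly_Mapping.lookup s j"
        using i(1) pos nth_mem[OF i(1)] by (intro bexI[of _ i]) (auto simp: st lookup_add)
    qed (auto simp: st lookup_add)
    from less.hyps[OF this t] obtain u where u: "u \<in> reduced_monomials ms"
      "Poly_Mapping.single t a - Poly_Mapping.single u a \<in> circulant_ideal ms" by blast
    have "Poly_Mapping.single t a * (mvar i ^ (ms ! i) - 1) \<in> circulant_ideal ms"
      by (intro circulant_ideal_closed(3) circulant_ideal_gen i(1) mpoly_ring_closed(7) t)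
    moreover have "Poly_Mapping.single t a * (mvar i ^ (ms ! i) - 1) =
        Poly_Mapping.single s a - Poly_Mapping.single t a"
      by (simp add: mvar_power right_diff_distrib mult_single st)
    ultimately have "Poly_Mapping.single s a - Poly_Mapping.single t a \<in> circulant_ideal ms"
      by simp
    from circulant_ideal_closed(1)[OF this u(2)]
    have "Poly_Mapping.single s a - Poly_Mapping.single u a \<in> circulant_ideal ms" by simp
    then show ?thesis using u(1) by blast
  qed
qed

text \<open>The terms are reduced one at a time, by induction over finite subsets of the support;
  the differences add up inside the ideal.\<close>

lemma polynomial_reduction:
  fixes p :: "'a::comm_ring_1 mpolynomial"
  assumes pos: "\<forall>m\<in>set ms. m > 0" and p: "p \<in> carrier (mpoly_ring (length ms))"
  shows "\<exists>b. Poly_Mapping.keys b \<subseteq> reduced_monomials ms \<and> p - b \<in> circulant_ideal ms"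
proof -
  have "\<exists>b. Poly_Mapping.keys b \<subseteq> reduced_monomials ms \<and>
      (\<Sum>s\<in>A. Poly_Mapping.single s (Poly_Mapping.lookup p s)) - b \<in> circulant_ideal ms"
    if "finite A" "A \<subseteq> Poly_Mapping.keys p" for A
    using that
  proof (induction A rule: finite_induct)
    case empty
    then show ?case by (intro exI[of _ 0]) (simp add: circulant_ideal_closed)
  next
    case (insert s A)
    let ?a = "Poly_Mapping.lookup p s"
    obtain b where b: "Poly_Mapping.keys b \<subseteq> reduced_monomials ms"
      "(\<Sum>s\<in>A. Poly_Mapping.single s (Poly_Mapping.lookup p s)) - b \<in> circulant_ideal ms"
      using insert by auto
    have "Poly_Mapping.keys s \<subseteq> {..<length ms}"
      using insert.prems p by (auto simp: mem_mpoly_ring)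
    from monomial_reduction[OF pos this, of ?a] obtain t where
      t: "t \<in> reduced_monomials ms" "Poly_Mapping.single s ?a - Poly_Mapping.single t ?a \<in> circulant_ideal ms"
      by blast
    show ?case
    proof (intro exI conjI)
      show "Poly_Mapping.keys (Poly_Mapping.single t ?a + b) \<subseteq> reduced_monomials ms"
        using Poly_Mapping.keys_add[of "Poly_Mapping.single t ?a" b] t(1) b(1)
        by (auto split: if_splits)
      show "(\<Sum>s\<in>insert s A. Poly_Mapping.single s (Poly_Mapping.lookup p s)) -
          (Poly_Mapping.single t ?a + b) \<in> circulant_ideal ms"
        using circulant_ideal_closed(1)[OF t(2) b(2)] insert.hyps by (simp add: algebra_simps)
    qed
  qed
  from this[of "Poly_Mapping.keys p"] show ?thesis by (simp add: sum_single_lookup)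
qed

lemma bij_betw_reduced_monomials:
  "bij_betw (\<lambda>s. \<lambda>i\<in>{..<length ms}. Poly_Mapping.lookup s i) (reduced_monomials ms)
     (\<Pi>\<^sub>E i\<in>{..<length ms}. {..<ms ! i})"
  (is "bij_betw ?f _ _")
proof (rule bij_betwI')
  fix s t assume st: "s \<in> reduced_monomials ms" "t \<in> reduced_monomials ms"
  show "?f s = ?f t \<longleftrightarrow> s = t"
  proof
    assume eq: "?f s = ?f t"
    show "s = t"
    proof (rule poly_mapping_eqI)
      fix i
      show "Poly_Mapping.lookup s i = Poly_Mapping.lookup t i"
      proof (cases "i < length ms")
        case True
        then show ?thesis using fun_cong[OF eq, of i] by simp
      next
        case False
        then have "i \<notin> Poly_Mapping.keys s" "i \<notin> Poly_Mapping.keys t"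
          using st by (auto simp: reduced_monomials_def)
        then show ?thesis by (simp add: in_keys_iff)
      qed
    qed
  qed simp
next
  fix s assume "s \<in> reduced_monomials ms"
  then show "?f s \<in> (\<Pi>\<^sub>E i\<in>{..<length ms}. {..<ms ! i})"
    by (auto simp: reduced_monomials_def)
next
  fix g assume g: "g \<in> (\<Pi>\<^sub>E i\<in>{..<length ms}. {..<ms ! i})"
  define s where "s = Abs_poly_mapping (\<lambda>i. if i < length ms then g i else 0)"
  have "finite {i. (if i < length ms then g i else 0) \<noteq> 0}"
    by (rule finite_subset[of _ "{..<length ms}"]) auto
  then have l: "Poly_Mapping.lookup s i = (if i < length ms then g i else 0)" for i
    unfolding s_def by (simp add: Abs_poly_mapping_inverse)
  show "\<exists>s\<in>reduced_monomials ms. g = ?f s"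
    using g by (intro bexI[of _ s])
      (auto simp: reduced_monomials_def l in_keys_iff PiE_iff extensional_def split: if_splits)
qed

lemma finite_reduced_monomials: "finite (reduced_monomials ms)"
  using bij_betw_finite[OF bij_betw_reduced_monomials[of ms]] by (simp add: finite_PiE)

lemma card_reduced_monomials: "card (reduced_monomials ms) = (\<Prod>i<length ms. ms ! i)"
  using bij_betw_same_card[OF bij_betw_reduced_monomials[of ms]] by (simp add: card_PiE)

text \<open>A coefficient function on \<open>A\<close> extends by \<open>0\<close> to a polynomial
  mapping, with finite support because \<open>A\<close> is finite. For \<open>A\<close> the reduced
  monomials this counts the normal forms.\<close>

lemma card_poly_mappings_supported_on:
  fixes A :: "'b set"
  assumes "finite A"
  shows "card {p :: 'b \<Rightarrow>\<^sub>0 'a::{zero,finite}. Poly_Mapping.keys p \<subseteq> A} = CARD('a) ^ card A"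
proof -
  have "bij_betw (\<lambda>p. \<lambda>s\<in>A. Poly_Mapping.lookup p s) {p :: 'b \<Rightarrow>\<^sub>0 'a. Poly_Mapping.keys p \<subseteq> A}
      (A \<rightarrow>\<^sub>E UNIV)"
    (is "bij_betw ?f _ _")
  proof (rule bij_betwI')
    fix p r :: "'b \<Rightarrow>\<^sub>0 'a"
    assume pr: "p \<in> {p. Poly_Mapping.keys p \<subseteq> A}" "r \<in> {p. Poly_Mapping.keys p \<subseteq> A}"
    show "?f p = ?f r \<longleftrightarrow> p = r"
    proof
      assume eq: "?f p = ?f r"
      show "p = r"
      proof (rule poly_mapping_eqI)
        fix s
        show "Poly_Mapping.lookup p s = Poly_Mapping.lookup r s"
        proof (cases "s \<in> A")
          case True
          then show ?thesis using fun_cong[OF eq, of s] by simp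
        next
          case False
          then have "s \<notin> Poly_Mapping.keys p" "s \<notin> Poly_Mapping.keys r"
            using pr by auto
          then show ?thesis by (simp add: in_keys_iff)
        qed
      qed
    qed simp
  next
    fix g :: "'b \<Rightarrow> 'a" assume g: "g \<in> A \<rightarrow>\<^sub>E UNIV"
    define p where "p = Abs_poly_mapping (\<lambda>s. if s \<in> A then g s else 0)"
    have "finite {s. (if s \<in> A then g s else 0) \<noteq> 0}"
      by (rule finite_subset[of _ A]) (auto simp: assms)
    then have l: "Poly_Mapping.lookup p s = (if s \<in> A then g s else 0)" for s
      unfolding p_def by (simp add: Abs_poly_mapping_inverse)
    show "\<exists>p\<in>{p. Poly_Mapping.keys p \<subseteq> A}. g = ?f p"
      using g by (intro bexI[of _ p])
        (auto simp: l in_keys_iff PiE_iff extensional_def split: if_splits)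
  qed auto
  from bij_betw_same_card[OF this] show ?thesis
    using assms by (simp add: card_PiE)
qed

section \<open>Semisimplicity forces coprimality\<close>

lemma direct_sum_ring_simps:
  "carrier (direct_sum_ring I S) = (\<Pi>\<^sub>E i\<in>I. carrier (S i))"
  "x \<otimes>\<^bsub>direct_sum_ring I S\<^esub> y = (\<lambda>i\<in>I. x i \<otimes>\<^bsub>S i\<^esub> y i)"
  "x \<oplus>\<^bsub>direct_sum_ring I S\<^esub> y = (\<lambda>i\<in>I. x i \<oplus>\<^bsub>S i\<^esub> y i)"
  "\<one>\<^bsub>direct_sum_ring I S\<^esub> = (\<lambda>i\<in>I. \<one>\<^bsub>S i\<^esub>)"
  "\<zero>\<^bsub>direct_sum_ring I S\<^esub> = (\<lambda>i\<in>I. \<zero>\<^bsub>S i\<^esub>)"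
  by (simp_all add: direct_sum_ring_def)

lemma ring_direct_sum_ring:
  assumes S: "\<And>i. i \<in> I \<Longrightarrow> ring (S i)"
  shows "ring (direct_sum_ring I S)"
proof -
  note group = ring.is_abelian_group[OF S] and mon = ring.is_monoid[OF S]
    and amon = abelian_group.axioms(1)[OF ring.is_abelian_group[OF S]]
  have elem: "x i \<in> carrier (S i)" if "x \<in> (\<Pi>\<^sub>E i\<in>I. carrier (S i))" "i \<in> I" for x i
    using that by (rule PiE_mem)
  note laws = abelian_monoid.a_assoc[OF amon] abelian_monoid.l_zero[OF amon]
    abelian_monoid.a_closed[OF amon] abelian_monoid.zero_closed[OF amon]
    monoid.m_closed[OF mon] monoid.one_closed[OF mon] monoid.m_assoc[OF mon]
    monoid.l_one[OF mon] monoid.r_one[OF mon] ring.ring_simprules(13,23)[OF S]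
  show ?thesis
  proof (rule ringI)
    show "abelian_group (direct_sum_ring I S)"
    proof (rule abelian_groupI; unfold direct_sum_ring_simps)
      fix x y assume x: "x \<in> (\<Pi>\<^sub>E i\<in>I. carrier (S i))" and y: "y \<in> (\<Pi>\<^sub>E i\<in>I. carrier (S i))"
      show "(\<lambda>i\<in>I. x i \<oplus>\<^bsub>S i\<^esub> y i) = (\<lambda>i\<in>I. y i \<oplus>\<^bsub>S i\<^esub> x i)"
        by (rule restrict_ext) (rule abelian_monoid.a_comm[OF amon elem[OF x] elem[OF y]])
    next
      fix x assume x: "x \<in> (\<Pi>\<^sub>E i\<in>I. carrier (S i))"
      show "\<exists>y\<in>\<Pi>\<^sub>E i\<in>I. carrier (S i). (\<lambda>i\<in>I. y i \<oplus>\<^bsub>S i\<^esub> x i) = (\<lambda>i\<in>I. \<zero>\<^bsub>S i\<^esub>)"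
        by (rule bexI[of _ "\<lambda>i\<in>I. \<ominus>\<^bsub>S i\<^esub> x i"])
          (use elem[OF x] in \<open>auto intro!: restrict_ext abelian_group.l_neg[OF group] abelian_group.a_inv_closed[OF group]\<close>)
    next
      fix x assume x: "x \<in> (\<Pi>\<^sub>E i\<in>I. carrier (S i))"
      show "(\<lambda>i\<in>I. (\<lambda>i\<in>I. \<zero>\<^bsub>S i\<^esub>) i \<oplus>\<^bsub>S i\<^esub> x i) = x"
        by (rule extensionalityI[of _ I])
          (use x in \<open>auto simp: laws elem PiE_iff\<close>)
    qed (auto intro!: restrict_ext laws elem simp: laws elem)
    show "Group.monoid (direct_sum_ring I S)"
      by (rule monoidI; unfold direct_sum_ring_simps)
        (auto intro!: restrict_ext laws elem simp: laws elem PiE_iff extensional_def fun_eq_iff)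
  qed (auto simp: direct_sum_ring_simps laws elem intro!: restrict_ext ring.ring_simprules(13,23)[OF S])
qed

lemma (in domain) nilpotent_imp_zero:
  assumes "x \<in> carrier R" "x [^] (n::nat) = \<zero>"
  shows "x = \<zero>"
  using assms(2) by (induction n) (use assms(1) integral in auto)

text \<open>Each simple component is a homomorphic image of the commutative ring \<open>R\<close>,
  hence commutative, hence a field. A nilpotent element therefore vanishes in every component, and
  the isomorphism is injective.\<close>

lemma semisimple_cring_reduced:
  fixes R :: "('a, 'b) ring_scheme" (structure)
  assumes "cring R" "semisimple_ring R"
    and x: "x \<in> carrier R" "x [^] (n::nat) = \<zero>"
  shows "x = \<zero>"
proof -
  interpret R: cring R by fact
  obtain k and S :: "nat \<Rightarrow> 'a ring" where W: "wedderburn_decomposition R {..<k} S"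
    using assms(2) by (auto simp: semisimple_ring_def)
  define T where "T = direct_sum_ring {..<k} S"
  have simple: "simple_ring (S i)" if "i < k" for i
    using W that by (auto simp: wedderburn_decomposition_def)
  then have ringS: "ring (S i)" if "i < k" for i
    using that by (auto simp: simple_ring_def)
  then have "ring T" unfolding T_def by (intro ring_direct_sum_ring) auto
  have "R \<simeq> T"
    using W unfolding wedderburn_decomposition_def T_def by blast
  then obtain h where "h \<in> ring_iso R T" unfolding is_ring_iso_def by blast
  then have h: "h \<in> ring_hom R T" "bij_betw h (carrier R) (carrier T)"
    unfolding ring_iso_def by blast+
  interpret h: ring_hom_ring R T h
    by (rule ring_hom_ringI2[OF R.ring_axioms \<open>ring T\<close> h(1)])
  have component: "h y i \<in> carrier (S i)" if "y \<in> carrier R" "i < k" for y i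
    using h.hom_closed[OF that(1)] that(2) unfolding T_def direct_sum_ring_simps by auto
  have proj: "ring_hom_ring R (S i) (\<lambda>y. h y i)" if "i < k" for i
    by (rule ring_hom_ringI)
      (use that component ringS R.ring_axioms in \<open>auto simp: T_def direct_sum_ring_simps\<close>)
  have zeroS: "\<zero>\<^bsub>S i\<^esub> \<in> carrier (S i)" if "i < k" for i
    by (rule abelian_monoid.zero_closed[OF abelian_group.axioms(1)[OF ring.is_abelian_group[OF ringS[OF that]]]])
  have surj: "\<exists>y\<in>carrier R. h y i = a" if "i < k" "a \<in> carrier (S i)" for i a
  proof -
    \<comment> \<open>The element \<open>a\<close> is placed in component \<open>i\<close> and zero
      elsewhere; a preimage of it under \<open>h\<close> projects to \<open>a\<close>.\<close>
    define A where "A = (\<lambda>j\<in>{..<k}. if j = i then a else \<zero>\<^bsub>S j\<^esub>)"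
    have "A \<in> carrier T"
      unfolding A_def T_def direct_sum_ring_simps
      using that by (auto simp: zeroS)
    then obtain y where "y \<in> carrier R" "h y = A"
      using h(2) by (metis bij_betw_imp_surj_on imageE)
    then show ?thesis using that by (intro bexI[of _ y]) (auto simp: A_def)
  qed
  have "h x i = \<zero>\<^bsub>S i\<^esub>" if i: "i < k" for i
  proof -
    interpret p: ring_hom_ring R "S i" "\<lambda>y. h y i" by (rule proj[OF i])
    have "a \<otimes>\<^bsub>S i\<^esub> b = b \<otimes>\<^bsub>S i\<^esub> a" if ab: "a \<in> carrier (S i)" "b \<in> carrier (S i)" for a b
    proof -
      obtain y z where yz: "y \<in> carrier R" "h y i = a" "z \<in> carrier R" "h z i = b"
        using surj[OF i ab(1)] surj[OF i ab(2)] by blast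
      show ?thesis
        using p.hom_mult[OF yz(1,3)] p.hom_mult[OF yz(3,1)] R.m_comm[OF yz(1,3)] yz by simp
    qed
    then have "cring (S i)"
      by (intro cring.intro comm_monoid.intro comm_monoid_axioms.intro
          ringS[OF i] ring.is_monoid[OF ringS[OF i]]) auto
    then have "field (S i)" using simple[OF i] simple_ring_iff_field by blast
    then interpret F: field "S i" .
    have "h x i [^]\<^bsub>S i\<^esub> n = \<zero>\<^bsub>S i\<^esub>"
      using p.hom_nat_pow[OF x(1), of n] x(2) p.hom_zero by simp
    then show ?thesis using F.nilpotent_imp_zero component[OF x(1) i] by blast
  qed
  then have "h x = h \<zero>"
    unfolding h.hom_zero using h.hom_closed[OF x(1)] unfolding T_def direct_sum_ring_simps
    by (intro extensionalityI[of _ "{..<k}"]) (auto simp: PiE_iff)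
  then show ?thesis
    using h(2) x(1) by (auto simp: bij_betw_def inj_on_def)
qed

lemma (in coefficient_hom) insertion_ring_hom:
  "ring_hom_ring (mpoly_ring n) (ring_of_type_algebra :: 'b ring) (insertion n x)"
  by (rule ring_hom_ringI[OF cring.axioms(1)[OF cring_mpoly_ring] ring_from_type_algebra])
    (simp_all add: insertion_mult insertion_add insertion_1 ring_of_type_algebra_def)

text \<open>Sending \<open>X\<^sub>i\<close> to \<open>X\<close> and the other variables to \<open>1\<close> maps the circulant ideal into the
  multiples of \<open>X\<^bsup>m\<^esup> - 1\<close> in the univariate polynomial ring.\<close>

lemma mvar_power_diff_not_in_circulant_ideal:
  assumes i: "i < length ms" and r: "0 < r" "r < ms ! i"
  shows "mvar i ^ r - 1 \<notin> (circulant_ideal ms :: 'a::field mpolynomial set)"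
proof
  assume mem: "mvar i ^ r - 1 \<in> (circulant_ideal ms :: 'a mpolynomial set)"
  define n where "n = length ms"
  define V :: "nat \<Rightarrow> 'a poly" where "V = (\<lambda>j. if j = i then Polynomial.monom 1 1 else 1)"
  define Q :: "'a poly" where "Q = Polynomial.monom 1 (ms ! i) - 1"
  interpret c: coefficient_hom "\<lambda>a::'a. [:a:]"
    by unfold_locales (simp_all add: one_pCons)
  interpret e: ring_hom_ring "mpoly_ring n" "ring_of_type_algebra :: 'a poly ring" "c.insertion n V"
    by (rule c.insertion_ring_hom)
  \<comment> \<open>This is the preimage of the principal ideal generated by \<open>Q\<close>, hence
    an ideal of the polynomial ring.\<close>
  define I where "I = {p \<in> carrier (mpoly_ring n). Q dvd c.insertion n V p}"
  have "cring (ring_of_type_algebra :: 'a poly ring)" by (rule cring_from_type_algebra)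
  then have "ideal (cgenideal ring_of_type_algebra Q) (ring_of_type_algebra :: 'a poly ring)"
    by (rule cring.cgenideal_ideal) (simp add: ring_of_type_algebra_def)
  moreover have "cgenideal ring_of_type_algebra Q = {f. Q dvd f}"
    by (auto simp: cgenideal_def ring_of_type_algebra_def dvd_def mult.commute)
  ultimately have "ideal I (mpoly_ring n)"
    using e.ideal_vimage[of "cgenideal ring_of_type_algebra Q"] by (simp add: I_def)
  moreover have pow: "Polynomial.monom (1::'a) 1 ^ k = Polynomial.monom 1 k" for k
    by (simp add: monom_power)
  have gen: "mvar j ^ k - 1 \<in> carrier (mpoly_ring n)"
      "c.insertion n V (mvar j ^ k - 1) = V j ^ k - 1" if "j < n" for j k
    using that by (auto intro!: mpoly_ring_closed_diff mpoly_ring_closed_power mpoly_ring_closed(5,6)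
        simp: c.insertion_minus c.insertion_power c.insertion_mvar c.insertion_1)
  \<comment> \<open>The generator maps to \<open>0\<close> for \<open>j \<noteq> i\<close> and to
    \<open>Q\<close> itself for \<open>j = i\<close>.\<close>
  have "mvar j ^ (ms ! j) - 1 \<in> I" if "j < length ms" for j
    using gen[of j "ms ! j"] that
    by (auto simp: I_def V_def Q_def pow n_def simp del: One_nat_def)
  ultimately have "circulant_ideal ms \<subseteq> I"
    unfolding n_def by (intro circulant_ideal_minimal)
  then have "mvar i ^ r - 1 \<in> I" using mem by blast
  then have "Q dvd V i ^ r - 1"
    unfolding I_def using gen(2)[of i r] i by (simp add: n_def)
  then have dvd: "Q dvd Polynomial.monom 1 r - 1" by (simp add: V_def pow del: One_nat_def)
  have deg: "Polynomial.degree (Polynomial.monom (1::'a) k - 1) = k" if "k > 0" for k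
    unfolding diff_conv_add_uminus
    using that by (subst degree_add_eq_left) (auto simp: degree_monom_eq)
  \<comment> \<open>A nonzero multiple of \<open>Q\<close> has degree at least
    \<open>ms ! i\<close>, but this one has degree \<open>r < ms ! i\<close>.\<close>
  have "Polynomial.monom 1 r - 1 \<noteq> (0 :: 'a poly)" using deg[OF r(1)] r(1) by auto
  from dvd_imp_degree_le[OF dvd this] show False
    using deg[OF r(1)] deg[of "ms ! i"] r by (simp add: Q_def)
qed

lemma CHAR_mpolynomial_dvd: "CHAR('a::comm_ring_1 mpolynomial) dvd CHAR('a)"
proof -
  have "of_nat CHAR('a) = (Poly_Mapping.single 0 (of_nat CHAR('a)) :: 'a mpolynomial)"
    by (rule single_of_nat[symmetric])
  also have "\<dots> = 0" by (simp only: of_nat_CHAR single_zero)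
  finally show ?thesis by (simp only: of_nat_eq_0_iff_char_dvd)
qed

text \<open>If \<open>p\<close> divides both \<open>m = p r\<close> and \<open>q\<close>, then \<open>(X\<^bsup>r\<^esup> - 1)\<^bsup>p\<^esup> = X\<^bsup>m\<^esup> - 1\<close>, so \<open>X\<^bsup>r\<^esup> - 1\<close> is nilpotent.\<close>

lemma semisimple_circulant_ring_imp_coprime:
  assumes pos: "\<forall>m\<in>set ms. m > 0"
    and ss: "semisimple_ring (circulant_ring ms :: 'a::finite_field mpolynomial set ring)"
    and m: "m \<in> set ms"
  shows "coprime m CARD('a)"
proof (rule ccontr)
  assume "\<not> coprime m CARD('a)"
  then obtain p where p: "Factorial_Ring.prime p" "p dvd m" "p dvd CARD('a)"
    by (metis coprime_iff_gcd_eq_1 gcd_greatest_iff prime_factor_nat)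
  then have char: "p = CHAR('a)" by (intro prime_dvd_CARD_finite_field)
  obtain i where i: "i < length ms" "ms ! i = m" using m by (metis in_set_conv_nth)
  obtain r where r: "m = p * r" using p(2) by blast
  have m0: "m > 0" using pos m by blast
  then have r0: "r > 0" using r by (cases r) auto
  have rm: "r < m" using r r0 prime_gt_1_nat[OF p(1)] by simp
  define y :: "'a mpolynomial" where "y = mvar i ^ r - 1"
  \<comment> \<open>The characteristic of the polynomial ring divides the prime \<open>p\<close>; it
    is not \<open>1\<close> because the constant coefficient of the polynomial \<open>1\<close> is
    nonzero.\<close>
  have charM: "CHAR('a mpolynomial) = p"
  proof -
    have "CHAR('a mpolynomial) \<noteq> 1"
    proof
      assume "CHAR('a mpolynomial) = 1"
      then have "of_nat 1 = (0 :: 'a mpolynomial)" using of_nat_CHAR[where ?'a = "'a mpolynomial"] by simp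
      then have "Poly_Mapping.lookup (1 :: 'a mpolynomial) 0 = 0" by simp
      then show False by simp
    qed
    moreover have "CHAR('a mpolynomial) dvd p" unfolding char by (rule CHAR_mpolynomial_dvd)
    ultimately show ?thesis using p(1) by (metis prime_nat_iff)
  qed
  \<comment> \<open>Here \<open>y + 1\<close> is \<open>mvar i ^ r\<close>, so the left side equals
    \<open>mvar i ^ m\<close>.\<close>
  have "(y + 1) ^ p = y ^ p + 1 ^ p"
    by (rule freshmans_dream) (use charM p(1) in simp_all)
  then have "y ^ p = mvar i ^ m - 1"
    by (simp add: y_def r mult.commute flip: power_mult)
  then have yp: "y ^ p \<in> circulant_ideal ms" using circulant_ideal_gen[OF i(1)] i(2) by simp
  define R where "R = (mpoly_ring (length ms) :: 'a mpolynomial ring)"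
  interpret I: ideal "circulant_ideal ms :: 'a mpolynomial set" R
    unfolding R_def by (rule ideal_circulant_ideal)
  let ?C = "R Quot circulant_ideal ms"
  have C: "?C = circulant_ring ms" by (simp add: R_def circulant_ring_eq)
  have zero: "\<zero>\<^bsub>?C\<^esub> = circulant_ideal ms" unfolding FactRing_def by (simp only: ring.simps)
  interpret f: ring_hom_ring R ?C "(+>\<^bsub>R\<^esub>) (circulant_ideal ms)" by (rule I.rcos_ring_hom_ring)
  have y: "y \<in> carrier R"
    unfolding y_def R_def
    by (intro mpoly_ring_closed_diff mpoly_ring_closed_power mpoly_ring_closed(5,6) i(1))
  \<comment> \<open>The class of \<open>y\<close> is nilpotent in the circulant ring. Reducedness
    puts \<open>y\<close> into the ideal, against
    \<open>mvar_power_diff_not_in_circulant_ideal\<close>.\<close>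
  have "(circulant_ideal ms +>\<^bsub>R\<^esub> y) [^]\<^bsub>?C\<^esub> p = circulant_ideal ms +>\<^bsub>R\<^esub> (y [^]\<^bsub>R\<^esub> p)"
    using f.hom_nat_pow[OF y] by simp
  also have "y [^]\<^bsub>R\<^esub> p = y ^ p" unfolding R_def by (rule mpoly_ring_pow)
  also have "circulant_ideal ms +>\<^bsub>R\<^esub> (y ^ p) = \<zero>\<^bsub>?C\<^esub>"
    unfolding zero by (rule I.a_rcos_zero[OF I.ideal_axioms yp])
  finally have "circulant_ideal ms +>\<^bsub>R\<^esub> y = \<zero>\<^bsub>?C\<^esub>"
  proof (rule semisimple_cring_reduced[rotated 3])
    show "cring ?C" by (rule I.quotient_is_cring) (simp add: R_def cring_mpoly_ring)
    show "semisimple_ring ?C" using ss by (simp add: C)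
    show "circulant_ideal ms +>\<^bsub>R\<^esub> y \<in> carrier ?C" using y by (rule f.hom_closed)
  qed
  then have "y \<in> circulant_ideal ms"
    unfolding zero by (rule I.rcos_const_imp_mem[OF y])
  then show False
    using mvar_power_diff_not_in_circulant_ideal[OF i(1) r0, where ?'a = 'a] rm i(2)
    by (simp add: y_def)
qed

section \<open>Fourier inversion and Frobenius orbits\<close>

interpretation ac: coefficient_hom "to_ac :: 'a::finite_field \<Rightarrow> 'a alg_closure"
  by unfold_locales simp_all

text \<open>Fourier inversion: \<open>(\<Prod> m\<^sub>i) b\<^sub>g = \<Sum>\<^sub>x b(x) x\<^bsup>-g\<^esup>\<close>, where \<open>x\<close> runs over the tuples of
  \<open>m\<^sub>i\<close>-th roots of unity and \<open>x\<^sub>i\<^bsup>-g\<^esup>\<close> is written as \<open>x\<^sub>i\<^bsup>m - g\<^esup>\<close>.\<close>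

lemma reduced_polynomial_eq_0:
  fixes b :: "'a::finite_field mpolynomial"
  assumes pos: "\<forall>m\<in>set ms. m > 0" and cop: "\<forall>m\<in>set ms. coprime m CARD('a)"
    and b: "Poly_Mapping.keys b \<subseteq> reduced_monomials ms"
    and van: "\<And>x. x \<in> (\<Pi>\<^sub>E i\<in>{..<length ms}. unity_roots (ms ! i)) \<Longrightarrow> ac.insertion (length ms) x b = 0"
  shows "b = 0"
proof (rule ccontr)
  assume "b \<noteq> 0"
  then obtain g where g: "g \<in> Poly_Mapping.keys b" by (metis all_not_in_conv keys_eq_empty)
  define n where "n = length ms"
  define U where "U i = (unity_roots (ms ! i) :: 'a alg_closure set)" for i
  have m: "ms ! i > 0" "coprime (ms ! i) CARD('a)" if "i < n" for i
    using that pos cop by (auto simp: n_def)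
  have g_lt: "Poly_Mapping.lookup g i < ms ! i" if "i < n" for i
    using g b that by (auto simp: reduced_monomials_def n_def)
  \<comment> \<open>The exponent difference of \<open>s\<close> and \<open>g\<close> at
    \<open>i\<close>, raised by \<open>ms ! i\<close> to stay natural. Both exponents are below
    \<open>ms ! i\<close> for reduced \<open>s\<close>, so \<open>ms ! i\<close> divides
    \<open>e s i\<close> only if they are equal.\<close>
  define e where "e s i = Poly_Mapping.lookup s i + (ms ! i - Poly_Mapping.lookup g i)" for s i
  define c where "c s = to_ac (Poly_Mapping.lookup b s)" for s
  \<comment> \<open>If \<open>s \<noteq> g\<close>, the two differ in some coordinate, and the
    factor of that coordinate vanishes by \<open>sum_unity_roots_power\<close>.\<close>
  have orth: "(\<Prod>i<n. \<Sum>z\<in>U i. z ^ e s i) = (if s = g then of_nat (\<Prod>i<n. ms ! i) else 0)"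
    if s: "s \<in> Poly_Mapping.keys b" for s
  proof (cases "s = g")
    case True
    then have "(\<Sum>z\<in>U i. z ^ e s i) = of_nat (ms ! i)" if "i < n" for i
      using g_lt[OF that] unfolding U_def
      by (subst sum_unity_roots_power) (auto simp: m that e_def)
    then show ?thesis using True by simp
  next
    case False
    have sred: "s \<in> reduced_monomials ms" and gred: "g \<in> reduced_monomials ms" using s g b by auto
    have "\<exists>i<n. Poly_Mapping.lookup s i \<noteq> Poly_Mapping.lookup g i"
    proof (rule ccontr)
      assume "\<not> ?thesis"
      then have eq: "Poly_Mapping.lookup s i = Poly_Mapping.lookup g i" if "i < n" for i
        using that by blast
      have "s = g"
      proof (rule poly_mapping_eqI)
        fix i
        show "Poly_Mapping.lookup s i = Poly_Mapping.lookup g i"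
        proof (cases "i < n")
          case False
          then have "i \<notin> Poly_Mapping.keys s" "i \<notin> Poly_Mapping.keys g"
            using sred gred by (auto simp: reduced_monomials_def n_def)
          then show ?thesis by (simp add: in_keys_iff)
        qed (rule eq)
      qed
      then show False using False by blast
    qed
    then obtain i where i: "i < n" "Poly_Mapping.lookup s i \<noteq> Poly_Mapping.lookup g i" by blast
    have "Poly_Mapping.lookup s i < ms ! i"
      using sred i(1) by (auto simp: reduced_monomials_def n_def)
    have "\<not> ms ! i dvd e s i"
    proof
      assume "ms ! i dvd e s i"
      then have "[e s i = 0] (mod ms ! i)" by (simp add: cong_0_iff)
      then have "[e s i + Poly_Mapping.lookup g i = 0 + Poly_Mapping.lookup g i] (mod ms ! i)"
        by (rule cong_add) simp
      moreover have "e s i + Poly_Mapping.lookup g i = Poly_Mapping.lookup s i + ms ! i"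
        using g_lt[OF i(1)] by (simp add: e_def)
      ultimately have "Poly_Mapping.lookup s i mod ms ! i = Poly_Mapping.lookup g i mod ms ! i"
        by (simp add: cong_def)
      then show False
        using i(2) g_lt[OF i(1)] \<open>Poly_Mapping.lookup s i < ms ! i\<close> by simp
    qed
    then have "(\<Sum>z\<in>U i. z ^ e s i) = 0"
      unfolding U_def by (subst sum_unity_roots_power) (simp_all add: m i)
    then have "\<exists>i\<in>{..<n}. (\<Sum>z\<in>U i. z ^ e s i) = 0" using i(1) by blast
    then have "(\<Prod>i<n. \<Sum>z\<in>U i. z ^ e s i) = 0" by (rule prod_zero[OF finite_lessThan])
    then show ?thesis using False by simp
  qed
  have finU: "finite (U i)" if "i < n" for i
    unfolding U_def using m(1)[OF that] by (rule card_unity_roots_le)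
  have "0 = (\<Sum>x\<in>(\<Pi>\<^sub>E i\<in>{..<n}. U i). ac.insertion n x b * (\<Prod>i<n. x i ^ (ms ! i - Poly_Mapping.lookup g i)))"
    using van by (simp add: n_def U_def)
  also have "\<dots> = (\<Sum>x\<in>(\<Pi>\<^sub>E i\<in>{..<n}. U i). \<Sum>s\<in>Poly_Mapping.keys b. c s * (\<Prod>i<n. x i ^ e s i))"
    by (simp add: ac.insertion_def ac.monomial_value_def sum_distrib_right mult.assoc c_def e_def
        power_add prod.distrib)
  also have "\<dots> = (\<Sum>s\<in>Poly_Mapping.keys b. c s * (\<Sum>x\<in>(\<Pi>\<^sub>E i\<in>{..<n}. U i). \<Prod>i<n. x i ^ e s i))"
    by (subst sum.swap) (simp add: sum_distrib_left)
  \<comment> \<open>A sum over the grid of a product of one-variable functions factors into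
    one-variable sums.\<close>
  also have "\<dots> = (\<Sum>s\<in>Poly_Mapping.keys b. c s * (\<Prod>i<n. \<Sum>z\<in>U i. z ^ e s i))"
    by (intro sum.cong refl arg_cong2[where f = "(*)"] prod_sum_PiE[symmetric]) (simp_all add: finU)
  also have "\<dots> = (\<Sum>s\<in>Poly_Mapping.keys b. if s = g then c s * of_nat (\<Prod>i<n. ms ! i) else 0)"
    by (intro sum.cong refl) (simp add: orth del: of_nat_prod)
  also have "\<dots> = c g * of_nat (\<Prod>i<n. ms ! i)"
    using g by simp
  finally have "c g * of_nat (\<Prod>i<n. ms ! i) = 0" by (rule sym)
  moreover have "c g \<noteq> 0" using g by (simp add: c_def in_keys_iff)
  moreover have "of_nat (\<Prod>i<n. ms ! i) \<noteq> (0 :: 'a alg_closure)"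
    by (rule of_nat_neq_0_if_coprime_CARD) (use m in \<open>auto intro: prod_coprime_left\<close>)
  ultimately show False by (simp del: of_nat_prod)
qed

section \<open>The Frobenius action on tuples of roots of unity\<close>

text \<open>The restriction keeps the result extensional, so that it stays in
  \<open>points_of_type\<close> and an orbit can return to its starting function exactly.\<close>

definition frobenius_point :: "nat \<Rightarrow> (nat \<Rightarrow> 'a::finite_field alg_closure) \<Rightarrow> nat \<Rightarrow> 'a alg_closure" where
  "frobenius_point n x = (\<lambda>i\<in>{..<n}. x i ^ CARD('a))"

lemma frobenius_CARD_sum:
  fixes f :: "'b \<Rightarrow> 'a::finite_field alg_closure"
  shows "(\<Sum>s\<in>A. f s) ^ CARD('a) = (\<Sum>s\<in>A. f s ^ CARD('a))"
  by (induction A rule: infinite_finite_induct) (simp_all add: frobenius_CARD_add zero_power)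

text \<open>The coefficients lie in the ground field, so their \<open>CARD('a)\<close>-th powers are
  themselves, and this power map is a ring homomorphism of the closure.\<close>

lemma insertion_frobenius_point:
  fixes p :: "'a::finite_field mpolynomial"
  shows "ac.insertion n (frobenius_point n x) p = ac.insertion n x p ^ CARD('a)"
proof -
  have "ac.monomial_value n (frobenius_point n x) s = ac.monomial_value n x s ^ CARD('a)" for s
    by (simp add: ac.monomial_value_def frobenius_point_def prod_power_distrib mult.commute
        flip: power_mult)
  moreover have "to_ac a = to_ac a ^ CARD('a)" for a :: 'a
    by (simp only: finite_field_power_card_eq_same flip: to_ac_power)
  ultimately show ?thesis
    unfolding ac.insertion_def frobenius_CARD_sum power_mult_distrib by metis
qed

text \<open>Two consequences are used later: zeros of \<open>p\<close> propagate along orbits, and a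
  point fixed by \<open>k\<close> steps gives a value in the field with \<open>CARD('a) ^ k\<close>
  elements.\<close>

lemma insertion_frobenius_point_funpow:
  fixes p :: "'a::finite_field mpolynomial"
  shows "ac.insertion n ((frobenius_point n ^^ k) x) p = ac.insertion n x p ^ (CARD('a) ^ k)"
  by (induction k) (simp_all add: insertion_frobenius_point mult.commute flip: power_mult)

lemma frobenius_point_funpow_nth:
  fixes x :: "nat \<Rightarrow> 'a::finite_field alg_closure"
  assumes "i < n"
  shows "(frobenius_point n ^^ k) x i = x i ^ (CARD('a) ^ k)"
  by (induction k) (simp_all add: assms frobenius_point_def mult.commute flip: power_mult)

definition points_of_type :: "nat list \<Rightarrow> nat list \<Rightarrow> (nat \<Rightarrow> 'a::finite_field alg_closure) set" where
  "points_of_type ms ds = (\<Pi>\<^sub>E i\<in>{..<length ms}. primitive_roots (ms ! i div ds ! i))"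

context
  fixes ms ds :: "nat list"
  assumes pos: "\<forall>m\<in>set ms. m > 0" and cop: "\<forall>m\<in>set ms. coprime m CARD('a::finite_field)"
    and ds: "ds \<in> Div ms"
begin

lemma type_component:
  assumes "i < length ms"
  shows "ms ! i div ds ! i > 0" "coprime (ms ! i div ds ! i) CARD('a)"
proof -
  have *: "ms ! i > 0" "coprime (ms ! i) CARD('a)" "ds ! i dvd ms ! i"
    using assms pos cop ds by (auto simp: Div_def)
  then show "ms ! i div ds ! i > 0"
    by (metis dvd_div_eq_0_iff gr0I not_less0)
  have "ms ! i div ds ! i dvd ms ! i" using *(3) by (metis dvd_div_mult_self dvd_triv_left)
  then show "coprime (ms ! i div ds ! i) CARD('a)"
    using coprime_divisors[OF _ dvd_refl *(2)] by blast
qed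

lemma card_points_of_type:
  "card (points_of_type ms ds :: (nat \<Rightarrow> 'a alg_closure) set) = (\<Prod>i<length ms. totient (ms ! i div ds ! i))"
  unfolding points_of_type_def
  by (subst card_PiE) (auto intro!: prod.cong card_primitive_roots type_component)

lemma prod_totient_pos: "(\<Prod>i<length ms. totient (ms ! i div ds ! i)) > 0"
  by (intro prod_pos) (simp add: type_component)

text \<open>An infinite set has \<open>card\<close> equal to \<open>0\<close>, so a positive count
  already yields finiteness.\<close>

lemma finite_points_of_type: "finite (points_of_type ms ds :: (nat \<Rightarrow> 'a alg_closure) set)"
  using card_points_of_type prod_totient_pos by (metis card.infinite less_irrefl)

lemma nu_pos: "nu CARD('a) ms ds > 0"
  using nu_dvd_prod_totient[OF cop ds] prod_totient_pos by (rule dvd_pos_nat[rotated])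

text \<open>Raising to a power coprime to the exact order preserves that order.\<close>

lemma frobenius_point_type_closed:
  assumes x: "x \<in> (points_of_type ms ds :: (nat \<Rightarrow> 'a alg_closure) set)"
  shows "frobenius_point (length ms) x \<in> points_of_type ms ds"
proof -
  have "x i ^ CARD('a) \<in> primitive_roots (ms ! i div ds ! i)" if i: "i < length ms" for i
  proof -
    have "x i \<in> primitive_roots (ms ! i div ds ! i)" using x i by (auto simp: points_of_type_def)
    then have "(x i ^ CARD('a)) ^ k = 1 \<longleftrightarrow> ms ! i div ds ! i dvd CARD('a) * k" for k
      by (simp add: primitive_roots_def flip: power_mult)
    then show ?thesis
      using type_component(2)[OF i] by (simp add: primitive_roots_def coprime_dvd_mult_right_iff)
  qed
  then show ?thesis by (auto simp: points_of_type_def frobenius_point_def)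
qed

text \<open>Write \<open>q\<close> for \<open>CARD('a)\<close>. A coordinate of exact order
  \<open>e\<close> is fixed by \<open>k\<close> Frobenius steps iff \<open>q ^ k\<close> is
  \<open>1\<close> modulo \<open>e\<close>, that is, iff \<open>ord e q\<close> divides
  \<open>k\<close>. All coordinates together give the least common multiple, so \<open>nu\<close> is
  the common orbit length.\<close>

lemma frobenius_point_type_period:
  assumes x: "x \<in> (points_of_type ms ds :: (nat \<Rightarrow> 'a alg_closure) set)"
  shows "(frobenius_point (length ms) ^^ k) x = x \<longleftrightarrow> nu CARD('a) ms ds dvd k"
proof -
  have closed: "(frobenius_point (length ms) ^^ k) x \<in> points_of_type ms ds"
    by (induction k) (auto simp: x intro: frobenius_point_type_closed)
  have *: "x i ^ (CARD('a) ^ k) = x i \<longleftrightarrow> ord (ms ! i div ds ! i) CARD('a) dvd k"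
    if i: "i < length ms" for i
  proof -
    define e where "e = ms ! i div ds ! i"
    have prim: "x i ^ k = 1 \<longleftrightarrow> e dvd k" for k
      using x i by (auto simp: points_of_type_def primitive_roots_def e_def)
    have "x i \<noteq> 0" using prim[of e] type_component(1)[OF i] by (auto simp: e_def zero_power)
    have Q: "CARD('a) ^ k \<ge> 1" by simp
    then have "x i ^ (CARD('a) ^ k) = x i * x i ^ (CARD('a) ^ k - 1)"
      by (metis power_eq_if not_one_le_zero)
    then have "x i ^ (CARD('a) ^ k) = x i \<longleftrightarrow> x i ^ (CARD('a) ^ k - 1) = 1"
      using \<open>x i \<noteq> 0\<close> by simp
    also have "\<dots> \<longleftrightarrow> [CARD('a) ^ k = 1] (mod e)"
      unfolding prim by (rule cong_altdef_nat[OF Q, symmetric])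
    also have "\<dots> \<longleftrightarrow> ord e CARD('a) dvd k" by (rule ord_divides)
    finally show ?thesis unfolding e_def .
  qed
  \<comment> \<open>Both functions are extensional, so agreement on the index range is
    equality.\<close>
  have "y = x" if "y \<in> points_of_type ms ds" "\<And>i. i < length ms \<Longrightarrow> y i = x i" for y
    by (rule PiE_ext[OF that(1)[unfolded points_of_type_def] x[unfolded points_of_type_def]])
      (simp add: that(2))
  from this[OF closed]
  have "(frobenius_point (length ms) ^^ k) x = x \<longleftrightarrow>
      (\<forall>i<length ms. (frobenius_point (length ms) ^^ k) x i = x i)"
    by auto
  also have "\<dots> \<longleftrightarrow> (\<forall>i<length ms. ord (ms ! i div ds ! i) CARD('a) dvd k)"
    using * by (simp add: frobenius_point_funpow_nth)
  also have "\<dots> \<longleftrightarrow> nu CARD('a) ms ds dvd k"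
    unfolding nu_def by (auto simp: Lcm_dvd_iff)
  finally show ?thesis .
qed

lemma orbit_representatives_of_type:
  "\<exists>rep :: nat \<Rightarrow> nat \<Rightarrow> 'a alg_closure. (\<forall>j < eta CARD('a) ms ds. rep j \<in> points_of_type ms ds) \<and>
     (\<forall>x\<in>points_of_type ms ds. \<exists>j < eta CARD('a) ms ds. \<exists>k. x = (frobenius_point (length ms) ^^ k) (rep j))"
  using orbit_representatives(1)[OF finite_points_of_type nu_pos
    frobenius_point_type_closed frobenius_point_type_period]
  unfolding eta_def card_points_of_type .

lemma eta_times_nu:
  "eta CARD('a) ms ds * nu CARD('a) ms ds = card (points_of_type ms ds :: (nat \<Rightarrow> 'a alg_closure) set)"
  unfolding eta_def card_points_of_type using nu_dvd_prod_totient[OF cop ds] by simp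

end

section \<open>Partition of the tuples of roots of unity by type\<close>

lemma finite_Div:
  assumes "\<forall>m\<in>set ms. m > 0"
  shows "finite (Div ms)"
proof -
  have "finite (\<Union>m\<in>set ms. {d. d dvd m})"
    using assms by (auto intro: finite_divisors_nat)
  moreover have "Div ms \<subseteq> {ds. set ds \<subseteq> (\<Union>m\<in>set ms. {d. d dvd m}) \<and> length ds = length ms}"
    by (force simp: Div_def in_set_conv_nth)
  ultimately show ?thesis using finite_lists_length_eq finite_subset by blast
qed

lemma Union_points_of_type:
  assumes pos: "\<forall>m\<in>set ms. m > 0"
  shows "(\<Union>ds\<in>Div ms. points_of_type ms ds) =
    (\<Pi>\<^sub>E i\<in>{..<length ms}. unity_roots (ms ! i) :: 'a::finite_field alg_closure set)"
proof (intro equalityI subsetI)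
  fix x :: "nat \<Rightarrow> 'a alg_closure"
  assume "x \<in> (\<Union>ds\<in>Div ms. points_of_type ms ds)"
  then obtain ds where ds: "ds \<in> Div ms" "x \<in> points_of_type ms ds" by blast
  have "x i \<in> unity_roots (ms ! i)" if i: "i < length ms" for i
  proof -
    have "ds ! i dvd ms ! i" using ds(1) i by (simp add: Div_def)
    then have "ms ! i div ds ! i dvd ms ! i" by (metis dvd_div_mult_self dvd_triv_left)
    moreover have "x i \<in> primitive_roots (ms ! i div ds ! i)" using ds(2) i by (auto simp: points_of_type_def)
    ultimately show ?thesis by (simp add: primitive_roots_def unity_roots_def)
  qed
  then show "x \<in> (\<Pi>\<^sub>E i\<in>{..<length ms}. unity_roots (ms ! i))"
    using ds(2) by (auto simp: points_of_type_def PiE_iff)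
next
  fix x :: "nat \<Rightarrow> 'a alg_closure"
  assume x: "x \<in> (\<Pi>\<^sub>E i\<in>{..<length ms}. unity_roots (ms ! i))"
  have "\<forall>i. \<exists>e. i < length ms \<longrightarrow> e dvd ms ! i \<and> x i \<in> primitive_roots e"
  proof
    fix i
    show "\<exists>e. i < length ms \<longrightarrow> e dvd ms ! i \<and> x i \<in> primitive_roots e"
    proof (cases "i < length ms")
      case True
      then have "x i \<in> unity_roots (ms ! i)" "ms ! i > 0" using x pos by auto
      then show ?thesis using unity_roots_eq_Union_primitive_roots[of "ms ! i"] by blast
    qed simp
  qed
  then obtain e where e: "\<And>i. i < length ms \<Longrightarrow> e i dvd ms ! i \<and> x i \<in> primitive_roots (e i)"
    by metis
  \<comment> \<open>The type consists of the complementary divisors of the exact orders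
    \<open>e i\<close>.\<close>
  define ds where "ds = map (\<lambda>i. ms ! i div e i) [0..<length ms]"
  have nth: "ds ! i dvd ms ! i" "ms ! i div ds ! i = e i" if i: "i < length ms" for i
  proof -
    obtain d where d: "ms ! i = e i * d" using e[OF i] by blast
    have "ms ! i > 0" using i pos by simp
    then have "e i > 0" "d > 0" using d by auto
    moreover have "ds ! i = ms ! i div e i" using i by (simp add: ds_def)
    ultimately show "ds ! i dvd ms ! i" "ms ! i div ds ! i = e i" using d by simp_all
  qed
  have "ds \<in> Div ms" using nth(1) by (simp add: Div_def) (simp add: ds_def)
  moreover have "x \<in> points_of_type ms ds"
    using x e nth(2) by (auto simp: points_of_type_def PiE_iff)
  ultimately show "x \<in> (\<Union>ds\<in>Div ms. points_of_type ms ds)" by blast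
qed

text \<open>A point determines the exact orders of its coordinates, and \<open>ds ! i\<close> is
  recovered from the order \<open>ms ! i div ds ! i\<close> as its complementary divisor.\<close>

lemma points_of_type_disjoint:
  assumes pos: "\<forall>m\<in>set ms. m > 0" and D: "ds \<in> Div ms" "ds' \<in> Div ms" "ds \<noteq> ds'"
  shows "points_of_type ms ds \<inter> (points_of_type ms ds' :: (nat \<Rightarrow> 'a::finite_field alg_closure) set) = {}"
proof (rule ccontr)
  assume "\<not> ?thesis"
  then obtain x :: "nat \<Rightarrow> 'a alg_closure" where
    x: "x \<in> points_of_type ms ds" "x \<in> points_of_type ms ds'" by blast
  have "ds ! i = ds' ! i" if i: "i < length ms" for i
  proof -
    have "x i \<in> primitive_roots (ms ! i div ds ! i)" "x i \<in> primitive_roots (ms ! i div ds' ! i)"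
      using x i by (auto simp: points_of_type_def)
    then have "ms ! i div ds ! i = ms ! i div ds' ! i" by (rule primitive_roots_unique)
    moreover have "ds ! i dvd ms ! i" "ds' ! i dvd ms ! i" "ms ! i > 0"
      using D i pos by (auto simp: Div_def)
    ultimately show ?thesis
      by (metis dvd_mult_div_cancel dvd_div_eq_0_iff mult_cancel2 not_less0)
  qed
  moreover have "length ds = length ms" "length ds' = length ms" using D by (auto simp: Div_def)
  ultimately show False using D(3) by (simp add: list_eq_iff_nth_eq)
qed

section \<open>Assembling the isomorphism\<close>

lemma finite_ext_field_simps:
  "carrier (finite_ext_field k :: 'a::finite_field alg_closure ring) = {x. x ^ (CARD('a) ^ k) = x}"
  "x \<oplus>\<^bsub>finite_ext_field k\<^esub> y = x + y" "x \<otimes>\<^bsub>finite_ext_field k\<^esub> y = x * y"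
  "\<one>\<^bsub>finite_ext_field k\<^esub> = 1" "\<zero>\<^bsub>finite_ext_field k\<^esub> = 0"
  by (simp_all add: finite_ext_field_def ring_of_type_algebra_def)

text \<open>Both sides count the tuples of roots of unity: the left by type, with \<open>eta\<close>
  orbits of length \<open>nu\<close> in each, the right coordinate by coordinate. This matches the
  size of the direct sum with the number of reduced polynomials.\<close>

lemma sum_eta_times_nu:
  assumes pos: "\<forall>m\<in>set ms. m > 0" and cop: "\<forall>m\<in>set ms. coprime m CARD('a::finite_field)"
  shows "(\<Sum>ds\<in>Div ms. eta CARD('a) ms ds * nu CARD('a) ms ds) = (\<Prod>i<length ms. ms ! i)"
proof -
  let ?Z = "(\<Pi>\<^sub>E i\<in>{..<length ms}. unity_roots (ms ! i)) :: (nat \<Rightarrow> 'a alg_closure) set"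
  have "(\<Sum>ds\<in>Div ms. eta CARD('a) ms ds * nu CARD('a) ms ds) =
      (\<Sum>ds\<in>Div ms. card (points_of_type ms ds :: (nat \<Rightarrow> 'a alg_closure) set))"
    by (intro sum.cong refl eta_times_nu[OF pos cop])
  also have "\<dots> = card (\<Union>ds\<in>Div ms. points_of_type ms ds :: (nat \<Rightarrow> 'a alg_closure) set)"
    by (intro card_UN_disjoint[symmetric] finite_Div pos ballI impI)
      (simp_all add: finite_points_of_type[OF pos cop] points_of_type_disjoint[OF pos])
  also have "\<dots> = card ?Z" by (simp only: Union_points_of_type[OF pos])
  also have "\<dots> = (\<Prod>i<length ms. ms ! i)"
    using pos cop by (subst card_PiE) (auto intro!: prod.cong card_unity_roots)
  finally show ?thesis .
qed

lemma circulant_ring_iso: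
  fixes ms :: "nat list"
  assumes pos: "\<forall>m\<in>set ms. m > 0" and cop: "\<forall>m\<in>set ms. coprime m CARD('a::finite_field)"
  shows "(circulant_ring ms :: 'a mpolynomial set ring) \<simeq>
    direct_sum_ring (SIGMA ds : Div ms. {..<eta CARD('a) ms ds})
      (\<lambda>(ds, j). finite_ext_field (nu CARD('a) ms ds) :: 'a alg_closure ring)"
proof -
  define n where "n = length ms"
  define I where "I = (SIGMA ds : Div ms. {..<eta CARD('a) ms ds})"
  define F :: "nat list \<times> nat \<Rightarrow> 'a alg_closure ring"
    where "F = (\<lambda>(ds, j). finite_ext_field (nu CARD('a) ms ds))"
  define R where "R = (mpoly_ring n :: 'a mpolynomial ring)"
  define T where "T = direct_sum_ring I F"
  define B :: "'a mpolynomial set" where "B = {b. Poly_Mapping.keys b \<subseteq> reduced_monomials ms}"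
  have finI: "finite I" unfolding I_def using finite_Div[OF pos] by simp
  have "\<forall>ds. \<exists>rep :: nat \<Rightarrow> nat \<Rightarrow> 'a alg_closure. ds \<in> Div ms \<longrightarrow>
      (\<forall>j < eta CARD('a) ms ds. rep j \<in> points_of_type ms ds) \<and>
      (\<forall>x\<in>points_of_type ms ds. \<exists>j < eta CARD('a) ms ds. \<exists>k. x = (frobenius_point n ^^ k) (rep j))"
    using orbit_representatives_of_type[OF pos cop] unfolding n_def by blast
  then obtain rep :: "nat list \<Rightarrow> nat \<Rightarrow> nat \<Rightarrow> 'a alg_closure" where
    rep: "\<And>ds j. ds \<in> Div ms \<Longrightarrow> j < eta CARD('a) ms ds \<Longrightarrow> rep ds j \<in> points_of_type ms ds" and
    orbit: "\<And>ds x. ds \<in> Div ms \<Longrightarrow> x \<in> points_of_type ms ds \<Longrightarrow>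
      \<exists>j < eta CARD('a) ms ds. \<exists>k. x = (frobenius_point n ^^ k) (rep ds j)"
    by metis
  define ev where "ev p = (\<lambda>(ds, j)\<in>I. ac.insertion n (rep ds j) p)" for p
  have ev_nth: "ev p (ds, j) = ac.insertion n (rep ds j) p" if "(ds, j) \<in> I" for p ds j
    using that by (simp add: ev_def)
  \<comment> \<open>Each representative of type \<open>ds\<close> is fixed by
    \<open>nu CARD('a) ms ds\<close> Frobenius steps, so values there satisfy the equation that
    defines the component field.\<close>
  have ev_closed: "ev p \<in> carrier T" for p
  proof -
    have "ac.insertion n (rep ds j) p ^ (CARD('a) ^ nu CARD('a) ms ds) = ac.insertion n (rep ds j) p"
      if "(ds, j) \<in> I" for ds j
    proof -
      have d: "ds \<in> Div ms" "j < eta CARD('a) ms ds" using that by (auto simp: I_def)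
      have "(frobenius_point n ^^ nu CARD('a) ms ds) (rep ds j) = rep ds j"
        using frobenius_point_type_period[OF pos cop d(1) rep[OF d]] by (simp add: n_def)
      then show ?thesis by (metis insertion_frobenius_point_funpow)
    qed
    then show ?thesis
      by (auto simp: T_def direct_sum_ring_simps ev_def F_def finite_ext_field_simps)
  qed
  have cringR: "cring R" unfolding R_def by (rule cring_mpoly_ring)
  have fieldF: "field (F i)" for i
    unfolding F_def by (cases i) (simp add: field_finite_ext_field)
  have "ring T"
    unfolding T_def by (intro ring_direct_sum_ring cring.axioms(1) fieldF domain.axioms(1) field.axioms(1))
  have F_simps: "x \<oplus>\<^bsub>F i\<^esub> y = x + y" "x \<otimes>\<^bsub>F i\<^esub> y = x * y" "\<one>\<^bsub>F i\<^esub> = 1" "\<zero>\<^bsub>F i\<^esub> = 0" for i x y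
    unfolding F_def by (cases i; simp add: finite_ext_field_simps)+
  interpret ev: ring_hom_ring R T ev
    by (rule ring_hom_ringI[OF cring.axioms(1)[OF cringR] \<open>ring T\<close>], rule ev_closed)
      (auto simp: R_def T_def direct_sum_ring_simps F_simps ev_def
        ac.insertion_mult ac.insertion_add ac.insertion_1)
  have zeroT: "\<zero>\<^bsub>T\<^esub> = (\<lambda>i\<in>I. 0)" by (simp add: T_def direct_sum_ring_simps F_simps)
  \<comment> \<open>Every tuple of roots of unity is a Frobenius iterate of some representative, so
    vanishing at the representatives spreads to all tuples.\<close>
  have vanish: "ac.insertion n x p = 0"
    if p: "ev p = \<zero>\<^bsub>T\<^esub>" and x: "x \<in> (\<Pi>\<^sub>E i\<in>{..<length ms}. unity_roots (ms ! i))" for p x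
  proof -
    obtain ds where ds: "ds \<in> Div ms" "x \<in> points_of_type ms ds"
      using x unfolding Union_points_of_type[OF pos, symmetric] by blast
    obtain j k where j: "j < eta CARD('a) ms ds" "x = (frobenius_point n ^^ k) (rep ds j)"
      using orbit[OF ds] by blast
    have "(ds, j) \<in> I" using ds(1) j(1) by (simp add: I_def)
    then have "ac.insertion n (rep ds j) p = 0"
      using ev_nth[of ds j p] p by (simp add: zeroT)
    then show ?thesis unfolding j(2) insertion_frobenius_point_funpow by (simp add: zero_power)
  qed
  have B0: "b = 0" if "b \<in> B" "ev b = \<zero>\<^bsub>T\<^esub>" for b
    by (rule reduced_polynomial_eq_0[OF pos cop]) (use that vanish in \<open>auto simp: B_def n_def\<close>)
  have ev_diff: "ev (p - r) = \<zero>\<^bsub>T\<^esub>" if "ev p = ev r" for p r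
  proof -
    have "ac.insertion n (rep ds j) p = ac.insertion n (rep ds j) r" if "(ds, j) \<in> I" for ds j
      using fun_cong[OF \<open>ev p = ev r\<close>, of "(ds, j)"] that by (simp add: ev_nth)
    then show ?thesis by (auto simp: ev_def zeroT ac.insertion_minus intro!: restrict_ext)
  qed
  have inj: "inj_on ev B"
  proof (rule inj_onI)
    fix b c assume bc: "b \<in> B" "c \<in> B" "ev b = ev c"
    have "b - c \<in> B"
    proof -
      have "Poly_Mapping.keys (b - c) \<subseteq> Poly_Mapping.keys b \<union> Poly_Mapping.keys c"
        by (auto simp: in_keys_iff lookup_minus)
      then show ?thesis using bc by (auto simp: B_def)
    qed
    then show "b = c" using B0[OF _ ev_diff[OF bc(3)]] by simp
  qed
  have BR: "B \<subseteq> carrier R"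
  proof
    fix b assume "b \<in> B"
    then show "b \<in> carrier R"
      unfolding B_def R_def n_def reduced_monomials_def mem_mpoly_ring by blast
  qed
  have cardB: "card B = CARD('a) ^ (\<Prod>i<length ms. ms ! i)"
    unfolding B_def by (simp add: card_poly_mappings_supported_on finite_reduced_monomials card_reduced_monomials)
  have "card (carrier T) = (\<Prod>i\<in>I. card (carrier (F i)))"
    unfolding T_def direct_sum_ring_simps by (rule card_PiE[OF finI])
  also have "\<dots> = (\<Prod>(ds, j)\<in>I. CARD('a) ^ nu CARD('a) ms ds)"
    by (intro prod.cong refl)
      (auto simp: F_def I_def intro!: card_finite_ext_field nu_pos[OF pos cop])
  also have "\<dots> = (\<Prod>ds\<in>Div ms. \<Prod>j<eta CARD('a) ms ds. CARD('a) ^ nu CARD('a) ms ds)"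
    unfolding I_def by (subst prod.Sigma) (simp_all add: finite_Div[OF pos])
  also have "\<dots> = CARD('a) ^ (\<Sum>ds\<in>Div ms. eta CARD('a) ms ds * nu CARD('a) ms ds)"
    by (simp add: power_sum mult.commute flip: power_mult)
  also have "\<dots> = card B" by (simp only: sum_eta_times_nu[OF pos cop] cardB)
  finally have cardT: "card (carrier T) = card B" .
  have "card B > 0" unfolding cardB by simp
  then have finT: "finite (carrier T)" using cardT card_ge_0_finite by metis
  \<comment> \<open>An injective map between finite sets of equal size is onto, so the reduced
    polynomials alone already reach every element.\<close>
  have "ev ` B = carrier T"
    by (rule card_subset_eq[OF finT]) (use ev_closed cardT card_image[OF inj] in auto)
  then have surj: "ev ` carrier R = carrier T"
    using BR ev_closed by blast
  have "a_kernel R T ev = circulant_ideal ms"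
  proof
    have gens: "mvar i ^ (ms ! i) - 1 \<in> a_kernel R T ev" if i: "i < length ms" for i
    proof -
      have "ac.insertion n (rep ds j) (mvar i ^ (ms ! i) - 1) = 0" if "(ds, j) \<in> I" for ds j
      proof -
        have "rep ds j \<in> (\<Union>ds\<in>Div ms. points_of_type ms ds)" using that rep by (auto simp: I_def)
        then have "rep ds j i \<in> unity_roots (ms ! i)"
          unfolding Union_points_of_type[OF pos] using i by blast
        then show ?thesis
          using i by (simp add: ac.insertion_minus ac.insertion_power ac.insertion_mvar ac.insertion_1
              unity_roots_def n_def)
      qed
      then have "ev (mvar i ^ (ms ! i) - 1) = \<zero>\<^bsub>T\<^esub>"
        by (auto simp: ev_def zeroT intro!: restrict_ext)
      moreover have "mvar i ^ (ms ! i) - 1 \<in> carrier R"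
        unfolding R_def n_def
        by (intro mpoly_ring_closed_diff mpoly_ring_closed_power mpoly_ring_closed(5,6) i)
      ultimately show ?thesis by (simp only: a_kernel_def') simp
    qed
    show "circulant_ideal ms \<subseteq> a_kernel R T ev"
      using ev.kernel_is_ideal gens unfolding R_def n_def by (rule circulant_ideal_minimal)
    show "a_kernel R T ev \<subseteq> circulant_ideal ms"
    proof
      fix p assume "p \<in> a_kernel R T ev"
      then have p: "p \<in> carrier R" "ev p = \<zero>\<^bsub>T\<^esub>" unfolding a_kernel_def' by blast+
      obtain b where b: "b \<in> B" "p - b \<in> circulant_ideal ms"
        using polynomial_reduction[OF pos p(1)[unfolded R_def n_def]] unfolding B_def by blast
      then have "p - b \<in> a_kernel R T ev"
        using \<open>circulant_ideal ms \<subseteq> a_kernel R T ev\<close> by blast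
      \<comment> \<open>Both values are zero. The difference of the two arguments is
        \<open>- b\<close>, which is again reduced and thus \<open>0\<close> by
        \<open>B0\<close>.\<close>
      then have "ev (p - b) = ev p" unfolding a_kernel_def' p(2) by blast
      from ev_diff[OF this] have "ev (- b) = \<zero>\<^bsub>T\<^esub>" by simp
      then have "b = 0" using B0[of "- b"] b(1) by (simp add: B_def subset_iff in_keys_iff)
      then show "p \<in> circulant_ideal ms" using b(2) by simp
    qed
  qed
  then show ?thesis
    using ev.FactRing_iso[OF surj] unfolding R_def T_def I_def F_def n_def circulant_ring_eq by simp
qed

theorem theorem4p13:
  fixes q :: nat and ms :: "nat list"
  assumes "q = CARD('a::finite_field)"
    and "\<forall>m\<in>set ms. m > 0"
    and "semisimple_ring (circulant_ring ms :: 'a mpolynomial set ring)"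
  shows "wedderburn_decomposition (circulant_ring ms :: 'a mpolynomial set ring)
           (SIGMA ds : Div ms. {..<eta q ms ds})
           (\<lambda>(ds, j). finite_ext_field (nu q ms ds) :: 'a alg_closure ring)"
proof -
  \<comment> \<open>This is where semisimplicity enters: it gives the coprimality on which all
    counts of roots of unity rest.\<close>
  have cop: "\<forall>m\<in>set ms. coprime m CARD('a)"
    using semisimple_circulant_ring_imp_coprime[OF assms(2,3)] by blast
  have "simple_ring (finite_ext_field k :: 'a alg_closure ring)" for k
    using field_finite_ext_field[of k, where ?'a = 'a] simple_ring_iff_field
      fieldE(1) by blast
  moreover have "finite (SIGMA ds : Div ms. {..<eta q ms ds})"
    using finite_Div[OF assms(2)] by simp
  ultimately show ?thesis
    using circulant_ring_iso[OF assms(2) cop] assms(1) by (auto simp: wedderburn_decomposition_def)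
qed

end
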